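(* Let $\Omega$ be a non-empty set, $V:\Omega\to\mathbb{R}$ a random variable, $R=V(\Omega)$ its range and $C=\operatorname{conv}(R)\subseteq\mathbb{R}$ the convex hull of its range. Assume $\mathfrak{a}_k:C\to\mathbb{R}$ is absolutely continuous for each $k\in R$. If $\mathfrak{a}=(\mathfrak{a}_k)_{k\in R}$ is proper for $V$ (respectively, strictly proper for $V$), then there is a positive, i.e. $m(t)\ge 0$ (respectively, strictly positive, i.e. $m(t)>0$), function $m$ such that for every $k\in R$ and every $x\in C$ $$\mathfrak{a}_k(x)=\mathfrak{a}_k(k)-\int_x^k (k-t)\,m(t)\,dt .$$ Moreover, $$m(t)=\frac{\mathfrak{a}_k'(t)}{k-t}$$ for all $k\in R$. (What is needed of (strict) propriety is only the condition for finitely supported probabilities; in fact it is needed only for probabilities that assign all their weight to two points of $\Omega$, at which $V$ takes values $k$ and $r$ in $R$, with expectation of $V$ equal to a given $t$ between $k$ and $r$.)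
   Context: A probability with finite support on $\Omega$ is a function $p:\Omega\to[0,1]$ with $p(\omega)>0$ for only finitely many $\omega$ and $\sum_{\omega\in\Omega}p(\omega)=1$. Write $\mathrm{Exp}_p[V]=\sum_{\omega}p(\omega)V(\omega)$ and $\mathrm{Exp}_p[\mathfrak{a}_V(x)]=\sum_{\omega}p(\omega)\,\mathfrak{a}_{V(\omega)}(x)$. The number $\mathfrak{a}_k(x)$ is the accuracy of providing the estimate $x$ for $V$ when its true value is $k$. The family $\mathfrak{a}$ is proper for $V$ if for every finitely supported probability $p$ the function $x\mapsto \mathrm{Exp}_p[\mathfrak{a}_V(x)]$ is maximised at $x=\mathrm{Exp}_p[V]$; it is strictly proper for $V$ if it is always uniquely maximised there. $\mathfrak{a}_k'$ denotes the derivative of $\mathfrak{a}_k$. When $a>b$, $\int_a^b f(t)\,dt$ means $-\int_b^a f(t)\,dt$.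
   Formalization: In the strictly proper case, "strictly positive, m(t)>0" is replaced by: m ≥ 0 on C and m > 0 on a set of positive measure in every nondegenerate subinterval of C, since m > 0 everywhere (or almost everywhere) can fail. *)

theory Defs
  imports "HOL-Probability.Probability"
begin

text \<open>
  \<open>a k x\<close> is the accuracy of the estimate \<open>x\<close> when the true value is \<open>k\<close>. Only the values with
  \<open>k\<close> in the range \<open>V ` \<Omega>\<close> and \<open>x\<close> in its convex hull are ever used.
\<close>

definition fin_probs :: "'w set \<Rightarrow> 'w pmf set" where
  "fin_probs \<Omega> = {p. finite (set_pmf p) \<and> set_pmf p \<subseteq> \<Omega>}"

text \<open>
  Since both points carry positive weight, the expectation of \<open>V\<close> lies strictly between the
  two values.
\<close>

definition two_point_probs :: "'w set \<Rightarrow> ('w \<Rightarrow> real) \<Rightarrow> 'w pmf set" where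
  "two_point_probs \<Omega> V = {p. \<exists>\<omega>\<in>\<Omega>. \<exists>\<omega>'\<in>\<Omega>. V \<omega> < V \<omega>' \<and> set_pmf p = {\<omega>, \<omega>'}}"

definition proper_for ::
  "'w pmf set \<Rightarrow> 'w set \<Rightarrow> ('w \<Rightarrow> real) \<Rightarrow> (real \<Rightarrow> real \<Rightarrow> real) \<Rightarrow> bool" where
  "proper_for P \<Omega> V a \<longleftrightarrow>
    (\<forall>p\<in>P. \<forall>x \<in> convex hull (V ` \<Omega>).
      measure_pmf.expectation p (\<lambda>\<omega>. a (V \<omega>) x)
        \<le> measure_pmf.expectation p (\<lambda>\<omega>. a (V \<omega>) (measure_pmf.expectation p V)))"

definition strictly_proper_for ::
  "'w pmf set \<Rightarrow> 'w set \<Rightarrow> ('w \<Rightarrow> real) \<Rightarrow> (real \<Rightarrow> real \<Rightarrow> real) \<Rightarrow> bool" where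
  "strictly_proper_for P \<Omega> V a \<longleftrightarrow>
    (\<forall>p\<in>P. \<forall>x \<in> convex hull (V ` \<Omega>). x \<noteq> measure_pmf.expectation p V \<longrightarrow>
      measure_pmf.expectation p (\<lambda>\<omega>. a (V \<omega>) x)
        < measure_pmf.expectation p (\<lambda>\<omega>. a (V \<omega>) (measure_pmf.expectation p V)))"

definition proper :: "'w set \<Rightarrow> ('w \<Rightarrow> real) \<Rightarrow> (real \<Rightarrow> real \<Rightarrow> real) \<Rightarrow> bool" where
  "proper \<Omega> V a \<longleftrightarrow> proper_for (fin_probs \<Omega>) \<Omega> V a"

definition strictly_proper :: "'w set \<Rightarrow> ('w \<Rightarrow> real) \<Rightarrow> (real \<Rightarrow> real \<Rightarrow> real) \<Rightarrow> bool" where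
  "strictly_proper \<Omega> V a \<longleftrightarrow> strictly_proper_for (fin_probs \<Omega>) \<Omega> V a"

text \<open>
  The usual \<open>\<epsilon>\<close>-\<open>\<delta>\<close> notion for functions on an interval; not related to
  \<^const>\<open>absolutely_continuous\<close>, which is about measures.
\<close>

definition absolutely_continuous_on :: "real set \<Rightarrow> (real \<Rightarrow> real) \<Rightarrow> bool" where
  "absolutely_continuous_on S f \<longleftrightarrow>
    (\<forall>\<epsilon>>0. \<exists>\<delta>>0. \<forall>I.
      finite I \<longrightarrow> (\<forall>(u, v)\<in>I. u \<in> S \<and> v \<in> S \<and> u < v) \<longrightarrow>
      disjoint_family_on (\<lambda>(u, v). {u<..<v}) I \<longrightarrow>
      (\<Sum>(u, v)\<in>I. v - u) < \<delta> \<longrightarrow> (\<Sum>(u, v)\<in>I. \<bar>f v - f u\<bar>) < \<epsilon>)"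

text \<open>
  Integrability is part of the claim because \<open>LBINT\<close> is 0 on non-integrable functions.
  \<open>LBINT t=x..k\<close> changes sign when \<open>x > k\<close>.
\<close>

definition integral_representation ::
  "real set \<Rightarrow> real set \<Rightarrow> (real \<Rightarrow> real \<Rightarrow> real) \<Rightarrow> (real \<Rightarrow> real) \<Rightarrow> bool" where
  "integral_representation R C a m \<longleftrightarrow>
    (\<forall>k\<in>R. \<forall>x\<in>C.
      interval_lebesgue_integrable lborel (ereal x) (ereal k) (\<lambda>t. (k - t) * m t) \<and>
      a k x = a k k - (LBINT t=ereal x..ereal k. (k - t) * m t))"

text \<open>
  An absolutely continuous function has a derivative only almost everywhere; the formula for
  \<open>m\<close> is claimed at every point \<open>t \<noteq> k\<close> where the derivative exists. At an end point of \<open>C\<close>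
  that belongs to \<open>C\<close>, the derivative is one-sided.
\<close>

definition derivative_formula ::
  "real set \<Rightarrow> real set \<Rightarrow> (real \<Rightarrow> real \<Rightarrow> real) \<Rightarrow> (real \<Rightarrow> real) \<Rightarrow> bool" where
  "derivative_formula R C a m \<longleftrightarrow>
    (\<forall>k\<in>R.
      (AE t\<in>C in lborel. a k differentiable (at t within C)) \<and>
      (\<forall>t \<in> C - {k}. \<forall>D. (a k has_real_derivative D) (at t within C) \<longrightarrow> m t = D / (k - t)))"

definition positive_on :: "real set \<Rightarrow> (real \<Rightarrow> real) \<Rightarrow> bool" where
  "positive_on C m \<longleftrightarrow> (\<forall>t\<in>C. 0 \<le> m t)"

text \<open>
  Strict positivity is that of the measure with density \<open>m\<close>: every nondegenerate interval contains
  a non-null set of points \<open>t\<close> with \<open>m t > 0\<close>. Demanding \<open>m t > 0\<close> at every (or almost every)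
  \<open>t\<close> would be too much. Take \<open>\<Omega> = {0, 1}\<close>, \<open>V\<close> the identity, \<open>m\<close> the indicator of a dense open
  \<open>U \<subseteq> {0..1}\<close> whose complement \<open>K\<close> has positive Lebesgue measure, and
  \<open>a k x = - (LBINT t=x..k. (k - t) * m t)\<close>. If \<open>V\<close> has expectation \<open>q\<close> under \<open>p\<close>, then the
  expected accuracy of \<open>q\<close> exceeds that of \<open>x\<close> by \<open>LBINT t=x..q. (q - t) * m t\<close>, which is
  positive for \<open>x \<noteq> q\<close>. So \<open>a\<close> is strictly proper and Lipschitz, yet the representation
  determines \<open>m\<close> up to null sets, so every choice of \<open>m\<close> vanishes almost everywhere on \<open>K\<close>.
\<close>

definition strictly_positive_on :: "real set \<Rightarrow> (real \<Rightarrow> real) \<Rightarrow> bool" where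
  "strictly_positive_on C m \<longleftrightarrow>
    positive_on C m \<and>
    (\<forall>u\<in>C. \<forall>v\<in>C. u < v \<longrightarrow> 0 < emeasure lborel {t \<in> {u<..<v}. 0 < m t})"

end

theory Submission
  imports Defs
begin

text \<open>
  For \<open>k < t < r\<close> with \<open>k, r \<in> R\<close> put \<open>M = (a r - a k) / (r - k)\<close>. Propriety for the two-point
  probability on \<open>k, r\<close> with expectation \<open>t\<close> says exactly that
  \<open>a k x - a k t \<le> (k - t) * (M x - M t)\<close> for all \<open>x\<close>. Exchanging \<open>x\<close> and \<open>t\<close> shows that \<open>M\<close>
  is increasing and that \<open>a k\<close> is an antiderivative of \<open>(k - t) dM(t)\<close>; this determines \<open>M\<close> up to
  a constant, so different pairs \<open>k, r\<close> give the same \<open>M\<close> up to constants and one pair serves all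
  of \<open>C\<close>. Since \<open>M\<close> is absolutely continuous and increasing, it has a density \<open>m\<close> by Radon-Nikodym,
  and \<open>m = M'\<close> almost everywhere. The integral of \<open>(k - t) * m t\<close> satisfies the same two-sided
  bounds as the increments of \<open>a k\<close>; the bounds differ by
  \<open>\<bar>x - t\<bar> * \<bar>M x - M t\<bar> = o(\<bar>x - t\<bar>)\<close>, so both have the same increments.
\<close>

section \<open>Increasing absolutely continuous functions\<close>

text \<open>The part of absolute continuity after the choice of \<open>\<delta>\<close>, named so
  that a \<open>\<delta>\<close> once obtained can be passed around as a single fact and applied to
  families of intervals.\<close>

definition ac_modulus :: "real set \<Rightarrow> (real \<Rightarrow> real) \<Rightarrow> real \<Rightarrow> real \<Rightarrow> bool" where
  "ac_modulus S f \<epsilon> \<delta> \<longleftrightarrow> (\<forall>I. finite I \<longrightarrow> (\<forall>(u, v)\<in>I. u \<in> S \<and> v \<in> S \<and> u < v) \<longrightarrow>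
      disjoint_family_on (\<lambda>(u, v). {u<..<v}) I \<longrightarrow>
      (\<Sum>(u, v)\<in>I. v - u) < \<delta> \<longrightarrow> (\<Sum>(u, v)\<in>I. \<bar>f v - f u\<bar>) < \<epsilon>)"

lemma absolutely_continuous_on_iff_ac_modulus:
  "absolutely_continuous_on S f \<longleftrightarrow> (\<forall>\<epsilon>>0. \<exists>\<delta>>0. ac_modulus S f \<epsilon> \<delta>)"
  unfolding absolutely_continuous_on_def ac_modulus_def by (rule refl)

lemma ac_modulusI:
  assumes "\<And>I. \<lbrakk>finite I; \<forall>(u, v)\<in>I. u \<in> S \<and> v \<in> S \<and> u < v;
       disjoint_family_on (\<lambda>(u, v). {u<..<v}) I; (\<Sum>(u, v)\<in>I. v - u) < \<delta>\<rbrakk>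
       \<Longrightarrow> (\<Sum>(u, v)\<in>I. \<bar>f v - f u\<bar>) < \<epsilon>"
  shows "ac_modulus S f \<epsilon> \<delta>"
  unfolding ac_modulus_def by (intro allI impI assms)

lemmas ac_modulusD =
  ac_modulus_def[THEN iffD1, THEN spec, THEN mp, THEN mp, THEN mp, THEN mp]

lemma absolutely_continuous_on_subset:
  assumes "absolutely_continuous_on S f" "T \<subseteq> S"
  shows "absolutely_continuous_on T f"
  unfolding absolutely_continuous_on_iff_ac_modulus
proof (intro allI impI)
  fix \<epsilon> :: real
  assume "0 < \<epsilon>"
  obtain \<delta> where \<delta>: "0 < \<delta>" "ac_modulus S f \<epsilon> \<delta>"
    using assms(1) \<open>0 < \<epsilon>\<close> unfolding absolutely_continuous_on_iff_ac_modulus by metis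
  have "ac_modulus T f \<epsilon> \<delta>"
    by (rule ac_modulusI, rule ac_modulusD[OF \<delta>(2)]) (use assms(2) in auto)
  then show "\<exists>\<delta>>0. ac_modulus T f \<epsilon> \<delta>" using \<delta>(1) by blast
qed

lemma absolutely_continuous_on_imp_continuous_on:
  assumes "absolutely_continuous_on S f"
  shows "continuous_on S f"
  unfolding continuous_on_iff
proof (intro ballI allI impI)
  fix x and \<epsilon> :: real assume x: "x \<in> S" "0 < \<epsilon>"
  obtain \<delta> where \<delta>: "0 < \<delta>" "ac_modulus S f \<epsilon> \<delta>"
    using assms x(2) unfolding absolutely_continuous_on_iff_ac_modulus by metis
  have *: "\<bar>f v - f u\<bar> < \<epsilon>" if "u \<in> S" "v \<in> S" "u < v" "v - u < \<delta>" for u v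
    using ac_modulusD[OF \<delta>(2), of "{(u, v)}"] that by (auto simp: disjoint_family_on_def)
  show "\<exists>d>0. \<forall>x'\<in>S. dist x' x < d \<longrightarrow> dist (f x') (f x) < \<epsilon>"
  proof (intro exI conjI ballI impI)
    fix y assume y: "y \<in> S" "dist y x < \<delta>"
    then show "dist (f y) (f x) < \<epsilon>"
      using *[of x y] *[of y x] x by (cases y x rule: linorder_cases) (auto simp: dist_real_def)
  qed fact
qed

lemma absolutely_continuous_on_scaled_diff:
  assumes "absolutely_continuous_on S f" "absolutely_continuous_on S g" "0 < (c::real)"
  shows "absolutely_continuous_on S (\<lambda>x. (f x - g x) / c)"
  unfolding absolutely_continuous_on_iff_ac_modulus
proof (intro allI impI)
  fix \<epsilon> :: real assume "0 < \<epsilon>"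
  \<comment> \<open>Each of \<open>f\<close> and \<open>g\<close> may contribute half of
    \<open>\<epsilon>\<close> after the division by \<open>c\<close>.\<close>
  then have pos: "0 < \<epsilon> * c / 2" using assms by simp
  obtain \<delta>1 where \<delta>1: "0 < \<delta>1" "ac_modulus S f (\<epsilon> * c / 2) \<delta>1"
    using assms(1) pos unfolding absolutely_continuous_on_iff_ac_modulus by metis
  obtain \<delta>2 where \<delta>2: "0 < \<delta>2" "ac_modulus S g (\<epsilon> * c / 2) \<delta>2"
    using assms(2) pos unfolding absolutely_continuous_on_iff_ac_modulus by metis
  have "ac_modulus S (\<lambda>x. (f x - g x) / c) \<epsilon> (min \<delta>1 \<delta>2)"
  proof (rule ac_modulusI)
    fix I :: "(real \<times> real) set"
    assume I: "finite I" "\<forall>(u, v)\<in>I. u \<in> S \<and> v \<in> S \<and> u < v"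
      "disjoint_family_on (\<lambda>(u, v). {u<..<v}) I" "(\<Sum>(u, v)\<in>I. v - u) < min \<delta>1 \<delta>2"
    have "(\<Sum>(u, v)\<in>I. \<bar>(f v - g v) / c - (f u - g u) / c\<bar>)
        \<le> (\<Sum>(u, v)\<in>I. (\<bar>f v - f u\<bar> + \<bar>g v - g u\<bar>) / c)"
    proof (rule sum_mono, clarify)
      fix u v
      have "\<bar>(f v - g v) / c - (f u - g u) / c\<bar> = \<bar>(f v - f u) - (g v - g u)\<bar> / c"
        using \<open>0 < c\<close> by (simp add: algebra_simps flip: diff_divide_distrib)
      also have "\<dots> \<le> (\<bar>f v - f u\<bar> + \<bar>g v - g u\<bar>) / c"
        using \<open>0 < c\<close> by (intro divide_right_mono) auto
      finally show "\<bar>(f v - g v) / c - (f u - g u) / c\<bar> \<le> (\<bar>f v - f u\<bar> + \<bar>g v - g u\<bar>) / c" .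
    qed
    also have "\<dots> = ((\<Sum>(u, v)\<in>I. \<bar>f v - f u\<bar>) + (\<Sum>(u, v)\<in>I. \<bar>g v - g u\<bar>)) / c"
      by (simp add: case_prod_beta sum.distrib flip: sum_divide_distrib)
    also have "\<dots> < (\<epsilon> * c / 2 + \<epsilon> * c / 2) / c"
      using I \<open>0 < c\<close> by (intro divide_strict_right_mono add_strict_mono ac_modulusD[OF \<delta>1(2)] ac_modulusD[OF \<delta>2(2)]) auto
    finally show "(\<Sum>(u, v)\<in>I. \<bar>(f v - g v) / c - (f u - g u) / c\<bar>) < \<epsilon>"
      using \<open>0 < c\<close> by simp
  qed
  then show "\<exists>\<delta>>0. ac_modulus S (\<lambda>x. (f x - g x) / c) \<epsilon> \<delta>"
    using \<delta>1(1) \<delta>2(1) by (intro exI[of _ "min \<delta>1 \<delta>2"]) auto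
qed

text \<open>A null set lies in an open set \<open>U\<close> of length less than
  \<open>\<delta>\<close>. Countably many nonoverlapping closed intervals inside \<open>U\<close>
  cover its part in \<open>{l..h}\<close>. Finitely many of them have total length below
  \<open>\<delta>\<close>, so absolute continuity bounds their Stieltjes measure by
  \<open>\<epsilon>\<close>, and the bound passes to the countable union.\<close>

lemma interval_measure_null:
  fixes G :: "real \<Rightarrow> real"
  assumes AC: "absolutely_continuous_on {l..h} G" and "l < h"
    and mono: "\<And>x y. x \<le> y \<Longrightarrow> G x \<le> G y" and cont: "continuous_on UNIV G"
    and N: "N \<in> null_sets lborel"
  shows "emeasure (interval_measure G) (N \<inter> {l..h}) = 0"
proof -
  let ?\<nu> = "interval_measure G"
  have le: "emeasure ?\<nu> (N \<inter> {l..h}) \<le> ennreal \<epsilon>" if "0 < \<epsilon>" for \<epsilon>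
  proof -
    obtain \<delta> where \<delta>: "0 < \<delta>" "ac_modulus {l..h} G \<epsilon> \<delta>"
      using AC \<open>0 < \<epsilon>\<close> unfolding absolutely_continuous_on_iff_ac_modulus by metis
    have NB[measurable]: "N \<in> sets borel" using N by auto
    obtain U where U: "open U" "N \<subseteq> U" "emeasure lborel (U - N) < \<delta>"
      using outer_regular_lborel[OF NB \<open>0 < \<delta>\<close>] .
    \<comment> \<open>Outer regularity bounds only \<open>U - N\<close>; since \<open>N\<close> is
      null, the bound holds for \<open>U\<close> too.\<close>
    have "emeasure lborel U = emeasure lborel (U - N)"
      using N U(1) by (simp add: emeasure_Diff_null_set)
    then have U\<delta>: "emeasure lborel U < \<delta>" using U(3) by simp
    \<comment> \<open>Every interval of the cover is subordinate to the gauge at one of its points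
      in \<open>N\<close>, and there the gauge is \<open>U\<close>; this forces the intervals into
      \<open>U\<close>.\<close>
    have g: "gauge (\<lambda>x. if x \<in> U then U else UNIV)"
      using U(1) by (auto simp: gauge_def)
    have sub: "N \<inter> {l..h} \<subseteq> cbox l h" by auto
    have ne: "box l h \<noteq> {}" using \<open>l < h\<close> by auto
    obtain \<D> where D: "countable \<D>" "\<Union>\<D> \<subseteq> cbox l h"
      "\<And>K. K \<in> \<D> \<Longrightarrow> interior K \<noteq> {} \<and> (\<exists>c d. K = cbox c d)"
      "pairwise (\<lambda>A B. interior A \<inter> interior B = {}) \<D>"
      "\<And>K. K \<in> \<D> \<Longrightarrow> \<exists>x \<in> (N \<inter> {l..h}) \<inter> K. K \<subseteq> (if x \<in> U then U else UNIV)"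
      "N \<inter> {l..h} \<subseteq> \<Union>\<D>"
      using covering_lemma[OF sub ne g] by metis
    have DU: "K \<subseteq> U" if "K \<in> \<D>" for K using D(5)[OF that] U(2) by (auto split: if_splits)
    define lo hi :: "real set \<Rightarrow> real" where "lo = Inf" and "hi = Sup"
    have K: "K = {lo K..hi K}" "lo K < hi K" "l \<le> lo K" "hi K \<le> h" if KD: "K \<in> \<D>" for K
    proof -
      obtain c d where cd: "K = {c..d}" "interior K \<noteq> {}" using D(3)[OF KD] by (metis cbox_interval)
      then have "c < d" by (auto simp: interior_atLeastAtMost_real)
      then have *: "lo K = c" "hi K = d" using cd by (auto simp: lo_def hi_def)
      then show "K = {lo K..hi K}" "lo K < hi K" using cd \<open>c < d\<close> by auto
      have "K \<subseteq> {l..h}" using D(2) KD by auto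
      then have "{c..d} \<subseteq> {l..h}" using cd(1) by simp
      then show "l \<le> lo K" "hi K \<le> h" using * \<open>c < d\<close> by auto
    qed
    have fin: "emeasure ?\<nu> (\<Union>E) \<le> \<epsilon>" if E: "finite E" "E \<subseteq> \<D>" for E
    proof -
      have KE: "K = {lo K..hi K}" "lo K < hi K" "l \<le> lo K" "hi K \<le> h" if "K \<in> E" for K
        using K[of K] E that by auto
      have dis: "disjoint_family_on (\<lambda>K. {lo K<..<hi K}) E"
        unfolding disjoint_family_on_def
      proof (intro ballI impI)
        fix A B assume AB: "A \<in> E" "B \<in> E" "A \<noteq> B"
        then have "interior A \<inter> interior B = {}" using D(4) E unfolding pairwise_def by blast
        moreover have "interior A = {lo A<..<hi A}" "interior B = {lo B<..<hi B}"
          using KE(1)[OF AB(1)] KE(1)[OF AB(2)] by (metis interior_atLeastAtMost_real)+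
        ultimately show "{lo A<..<hi A} \<inter> {lo B<..<hi B} = {}" by simp
      qed
      let ?p = "\<lambda>K. (lo K, hi K)"
      have inj: "inj_on ?p E" by (rule inj_onI) (metis KE(1) prod.inject)
      \<comment> \<open>The open interiors are disjoint subsets of \<open>U\<close>, so the total
        length is below \<open>\<delta>\<close>.\<close>
      have "ennreal (\<Sum>K\<in>E. hi K - lo K) = (\<Sum>K\<in>E. emeasure lborel {lo K<..<hi K})"
        using KE by (subst sum_ennreal[symmetric]) (auto intro!: sum.cong simp: less_imp_le)
      also have "\<dots> = emeasure lborel (\<Union>K\<in>E. {lo K<..<hi K})"
        using dis E by (intro sum_emeasure) auto
      also have "\<dots> \<le> emeasure lborel U"
        using DU KE(1) E U(1) by (intro emeasure_mono) fastforce+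
      finally have "ennreal (\<Sum>K\<in>E. hi K - lo K) < \<delta>" using U\<delta> by simp
      then have less: "(\<Sum>K\<in>E. hi K - lo K) < \<delta>"
        by (simp add: ennreal_less_iff sum_nonneg KE less_imp_le)
      have "(\<Sum>(u, v)\<in>?p ` E. \<bar>G v - G u\<bar>) < \<epsilon>"
      proof (rule ac_modulusD[OF \<delta>(2)])
        show "finite (?p ` E)" using E by simp
        show "\<forall>(u, v)\<in>?p ` E. u \<in> {l..h} \<and> v \<in> {l..h} \<and> u < v"
          using KE(2-4) by fastforce
        show "disjoint_family_on (\<lambda>(u, v). {u<..<v}) (?p ` E)"
          using dis unfolding disjoint_family_on_def by (auto 0 3)
        show "(\<Sum>(u, v)\<in>?p ` E. v - u) < \<delta>"
          using less by (simp add: sum.reindex[OF inj])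
      qed
      then have sumG: "(\<Sum>K\<in>E. \<bar>G (hi K) - G (lo K)\<bar>) < \<epsilon>" by (simp add: sum.reindex[OF inj])
      have "emeasure ?\<nu> (\<Union>E) \<le> (\<Sum>K\<in>E. emeasure ?\<nu> K)"
      proof -
        have "emeasure ?\<nu> (\<Union>K\<in>E. K) \<le> (\<Sum>K\<in>E. emeasure ?\<nu> K)"
          using E KE(1) by (intro emeasure_subadditive_finite) (auto, metis borel_closed closed_atLeastAtMost)
        then show ?thesis by simp
      qed
      also have "\<dots> = (\<Sum>K\<in>E. ennreal \<bar>G (hi K) - G (lo K)\<bar>)"
      proof (rule sum.cong[OF refl])
        fix K assume k: "K \<in> E"
        have "emeasure ?\<nu> {lo K..hi K} = G (hi K) - G (lo K)"
          using KE(2)[OF k] by (intro emeasure_interval_measure_Icc mono cont) auto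
        moreover have "G (lo K) \<le> G (hi K)" using KE(2)[OF k] by (intro mono) auto
        ultimately show "emeasure ?\<nu> K = ennreal \<bar>G (hi K) - G (lo K)\<bar>" using KE(1)[OF k] by simp
      qed
      also have "\<dots> = ennreal (\<Sum>K\<in>E. \<bar>G (hi K) - G (lo K)\<bar>)" by simp
      also have "\<dots> \<le> \<epsilon>" using sumG by (intro ennreal_leI) simp
      finally show ?thesis .
    qed
    have Dm: "\<And>K. K \<in> \<D> \<Longrightarrow> K \<in> sets borel" by (metis K(1) borel_closed closed_atLeastAtMost)
    have "emeasure ?\<nu> (\<Union>\<D>) \<le> \<epsilon>"
    proof (cases "\<D> = {}")
      case False
      \<comment> \<open>Increasing finite unions that exhaust the cover; continuity of the measure
        from below carries the bound for finite subfamilies to the whole.\<close>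
      define e where "e n = \<Union>(from_nat_into \<D> ` {..n})" for n
      have "\<Union>\<D> = \<Union>(range (from_nat_into \<D>))" using D(1) False by (simp add: range_from_nat_into)
      also have "\<dots> = (\<Union>n. e n)" unfolding e_def by blast
      finally have De: "\<Union>\<D> = (\<Union>n. e n)" .
      have em: "e n \<in> sets borel" for n unfolding e_def
        using Dm from_nat_into[OF False] by (intro sets.finite_Union) auto
      have "(SUP n. emeasure ?\<nu> (e n)) = emeasure ?\<nu> (\<Union>n. e n)"
        by (intro SUP_emeasure_incseq) (auto simp: em incseq_def, auto simp: e_def)
      moreover have "emeasure ?\<nu> (e n) \<le> \<epsilon>" for n
        unfolding e_def using from_nat_into[OF False] by (intro fin) auto
      ultimately show ?thesis unfolding De by (metis SUP_least)
    qed simp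
    moreover have "emeasure ?\<nu> (N \<inter> {l..h}) \<le> emeasure ?\<nu> (\<Union>\<D>)"
      using D(1,6) Dm by (intro emeasure_mono) (auto intro: sets.countable_Union)
    ultimately show ?thesis by (rule order_trans[rotated])
  qed
  have "emeasure ?\<nu> (N \<inter> {l..h}) \<le> 0"
    by (rule ennreal_le_epsilon) (use le in simp)
  then show ?thesis by simp
qed

text \<open>The Stieltjes measure of \<open>F\<close> on \<open>{l..h}\<close> vanishes on Lebesgue
  null sets, so Radon-Nikodym gives it a density. Its total mass is finite, which makes the density
  finite almost everywhere and hence replaceable by a real function.\<close>

lemma mono_absolutely_continuous_density:
  fixes F :: "real \<Rightarrow> real"
  assumes AC: "absolutely_continuous_on {l..h} F" and mono: "mono_on {l..h} F" and "l < h"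
  obtains g where "integrable lborel g"
    "\<And>x y. l \<le> x \<Longrightarrow> x \<le> y \<Longrightarrow> y \<le> h \<Longrightarrow> (LBINT t:{x..y}. g t) = F y - F x"
proof -
  \<comment> \<open>Clamping the argument extends \<open>F\<close> by constants to an increasing
    continuous function on the whole line, as \<open>interval_measure\<close> demands.\<close>
  define G where "G x = F (max l (min h x))" for x
  have GF: "G x = F x" if "x \<in> {l..h}" for x using that by (auto simp: G_def)
  have monoG: "G x \<le> G y" if "x \<le> y" for x y
    unfolding G_def using that \<open>l < h\<close> by (intro mono_onD[OF mono]) auto
  have contG: "continuous_on UNIV G" unfolding G_def
    by (rule continuous_on_compose2[OF absolutely_continuous_on_imp_continuous_on[OF AC]])
       (use \<open>l < h\<close> in \<open>auto intro!: continuous_intros\<close>)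
  have ACG: "absolutely_continuous_on {l..h} G"
    unfolding absolutely_continuous_on_iff_ac_modulus
  proof (intro allI impI)
    fix \<epsilon> :: real assume "0 < \<epsilon>"
    then obtain \<delta> where \<delta>: "0 < \<delta>" "ac_modulus {l..h} F \<epsilon> \<delta>"
      using AC unfolding absolutely_continuous_on_iff_ac_modulus by metis
    have "ac_modulus {l..h} G \<epsilon> \<delta>"
    proof (rule ac_modulusI)
      fix I :: "(real \<times> real) set"
      assume I: "finite I" "\<forall>(u, v)\<in>I. u \<in> {l..h} \<and> v \<in> {l..h} \<and> u < v"
        "disjoint_family_on (\<lambda>(u, v). {u<..<v}) I" "(\<Sum>(u, v)\<in>I. v - u) < \<delta>"
      have "(\<Sum>(u, v)\<in>I. \<bar>G v - G u\<bar>) = (\<Sum>(u, v)\<in>I. \<bar>F v - F u\<bar>)"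
        using I(2) GF by (intro sum.cong) fastforce+
      then show "(\<Sum>(u, v)\<in>I. \<bar>G v - G u\<bar>) < \<epsilon>" using ac_modulusD[OF \<delta>(2) I] by simp
    qed
    then show "\<exists>\<delta>>0. ac_modulus {l..h} G \<epsilon> \<delta>" using \<delta>(1) by blast
  qed
  let ?\<nu> = "interval_measure G"
  define N where "N = density ?\<nu> (indicator {l..h})"
  have setsN[simp]: "sets N = sets borel" by (simp add: N_def)
  have emN: "emeasure N A = emeasure ?\<nu> (A \<inter> {l..h})" if [measurable]: "A \<in> sets borel" for A
  proof -
    have "emeasure N A = (\<integral>\<^sup>+x. indicator {l..h} x * indicator A x \<partial>?\<nu>)"
      unfolding N_def using that by (subst emeasure_density) auto
    also have "\<dots> = (\<integral>\<^sup>+x. indicator (A \<inter> {l..h}) x \<partial>?\<nu>)"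
      by (intro nn_integral_cong) (auto simp: indicator_def)
    also have "\<dots> = emeasure ?\<nu> (A \<inter> {l..h})"
      using that by (subst nn_integral_indicator) auto
    finally show ?thesis .
  qed
  have emI: "emeasure N {x..y} = F y - F x" if "l \<le> x" "x \<le> y" "y \<le> h" for x y
  proof -
    have "{x..y} \<inter> {l..h} = {x..y}" using that by auto
    then have "emeasure N {x..y} = G y - G x"
      using that emeasure_interval_measure_Icc[OF \<open>x \<le> y\<close> monoG contG] by (simp add: emN)
    then show ?thesis using that GF by simp
  qed
  have "absolutely_continuous (lborel :: real measure) N"
    unfolding absolutely_continuous_def
  proof
    fix A :: "real set" assume A: "A \<in> null_sets lborel"
    then have "A \<in> sets borel" by auto
    then show "A \<in> null_sets N"
      using interval_measure_null[OF ACG \<open>l < h\<close> monoG contG A] by (auto simp: emN null_sets_def)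
  qed
  then obtain f where f: "f \<in> borel_measurable lborel" and fN: "density lborel f = N"
    using sigma_finite_measure.Radon_Nikodym[OF sigma_finite_lborel, of N] by auto
  have [measurable]: "f \<in> borel_measurable borel" using f by simp
  have emf: "emeasure N A = (\<integral>\<^sup>+t. f t * indicator A t \<partial>lborel)" if "A \<in> sets borel" for A
    unfolding fN[symmetric] using that by (subst emeasure_density) auto
  have "emeasure N UNIV = emeasure N {l..h}"
    using emN[of UNIV] emN[of "{l..h}"] by simp
  then have fin: "(\<integral>\<^sup>+t. f t \<partial>lborel) < \<infinity>"
    using emf[of UNIV] emI[of l h] \<open>l < h\<close> by (simp add: less_top)
  define g where "g t = enn2real (f t)" for t
  have [measurable]: "g \<in> borel_measurable borel" unfolding g_def by measurable
  have fg: "AE t in lborel. ennreal (g t) = f t"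
    using nn_integral_PInf_AE[of f lborel] fin unfolding g_def
    by (auto simp: less_top[symmetric] elim!: eventually_mono)
  show thesis
  proof (rule that)
    have "(\<integral>\<^sup>+t. ennreal (g t) \<partial>lborel) = (\<integral>\<^sup>+t. f t \<partial>lborel)"
      by (intro nn_integral_cong_AE fg)
    then show "integrable lborel g"
      using fin by (intro integrableI_nonneg) (auto simp: g_def)
    fix x y assume xy: "l \<le> x" "x \<le> y" "y \<le> h"
    have "(\<integral>\<^sup>+t. ennreal (indicator {x..y} t * g t) \<partial>lborel) = (\<integral>\<^sup>+t. f t * indicator {x..y} t \<partial>lborel)"
      using fg by (intro nn_integral_cong_AE) (auto elim!: eventually_mono simp: indicator_def)
    also have "\<dots> = ennreal (F y - F x)" using emf[of "{x..y}"] emI[OF xy] by simp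
    finally have "(\<integral>t. indicator {x..y} t * g t \<partial>lborel) = F y - F x"
      using mono_onD[OF mono, of x y] xy
      by (intro integral_eq_nn_integral[THEN trans]) (auto simp: g_def)
    then show "(LBINT t:{x..y}. g t) = F y - F x" by (simp add: set_lebesgue_integral_def)
  qed
qed

section \<open>Differentiation almost everywhere and a pointwise density\<close>

lemma negligible_AE_lborel: "negligible N \<Longrightarrow> AE x in lborel. x \<notin> N"
  by (metis AE_completion_iff AE_not_in negligible_iff_null_sets)

text \<open>Lebesgue differentiation in the form of \<open>integrable_ccontinuous_explicit\<close>
  controls averages over intervals that start at the point. It is applied to \<open>g\<close> for
  the right difference quotients and to the reflection of \<open>g\<close> for the left
  ones.\<close>

lemma AE_has_real_derivative_indefinite_integral:
  fixes F g :: "real \<Rightarrow> real"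
  assumes int: "\<And>a b. g integrable_on {a..b}"
    and F: "\<And>x y. l \<le> x \<Longrightarrow> x \<le> y \<Longrightarrow> y \<le> h \<Longrightarrow> integral {x..y} g = F y - F x"
  shows "AE t in lborel. t \<in> {l<..<h} \<longrightarrow> (F has_real_derivative g t) (at t)"
proof -
  have 1: "g integrable_on cbox a b" for a b using int by simp
  have 2: "(\<lambda>x. g (- x)) integrable_on cbox a b" for a b
    using 1[of "- b" "- a"] integrable_reflect[where f = g and a = "- b" and b = "- a"]
    by (simp only: minus_minus)
  obtain N1 where N1: "negligible N1" "\<And>x e. \<lbrakk>x \<notin> N1; 0 < e\<rbrakk> \<Longrightarrow> \<exists>d>0. \<forall>h. 0 < h \<and> h < d \<longrightarrow>
       norm (integral (cbox x (x + h *\<^sub>R One)) g /\<^sub>R h ^ DIM(real) - g x) < e"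
    using integrable_ccontinuous_explicit[OF 1] by metis
  obtain N2 where N2: "negligible N2" "\<And>x e. \<lbrakk>x \<notin> N2; 0 < e\<rbrakk> \<Longrightarrow> \<exists>d>0. \<forall>h. 0 < h \<and> h < d \<longrightarrow>
       norm (integral (cbox x (x + h *\<^sub>R One)) (\<lambda>x. g (- x)) /\<^sub>R h ^ DIM(real) - g (- x)) < e"
    using integrable_ccontinuous_explicit[OF 2] by metis
  \<comment> \<open>The exceptional set of the reflected function has to be reflected back.\<close>
  have "negligible (uminus ` N2)"
    using N2(1) by (intro negligible_differentiable_image_negligible)
      (auto simp: differentiable_on_def intro!: derivative_intros)
  have "AE t in lborel. t \<notin> N1 \<and> t \<notin> uminus ` N2"
    using N1(1) \<open>negligible (uminus ` N2)\<close> by (auto dest!: negligible_AE_lborel)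
  then show ?thesis
  proof (rule eventually_mono, intro impI)
    fix t assume t: "t \<notin> N1 \<and> t \<notin> uminus ` N2" "t \<in> {l<..<h}"
    then have t2: "- t \<notin> N2" by (metis image_eqI minus_minus)
    show "(F has_real_derivative g t) (at t)"
      unfolding has_field_derivative_iff LIM_eq
    proof (intro allI impI)
      fix e :: real assume "0 < e"
      obtain d1 where d1: "0 < d1" "\<And>h. 0 < h \<Longrightarrow> h < d1 \<Longrightarrow> \<bar>integral {t..t + h} g / h - g t\<bar> < e"
        using N1(2)[of t e] t \<open>0 < e\<close> by (auto simp: divide_inverse mult.commute)
      obtain d2 where d2: "0 < d2"
          "\<And>h. 0 < h \<Longrightarrow> h < d2 \<Longrightarrow> \<bar>integral {- t..- t + h} (\<lambda>x. g (- x)) / h - g t\<bar> < e"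
        using N2(2)[of "- t" e] t2 \<open>0 < e\<close> by (auto simp: divide_inverse mult.commute)
      show "\<exists>s>0. \<forall>y. y \<noteq> t \<and> norm (y - t) < s \<longrightarrow> norm ((F y - F t) / (y - t) - g t) < e"
      proof (intro exI conjI allI impI)
        show "0 < Min {d1, d2, t - l, h - t}" using d1 d2 t by auto
        fix y assume "y \<noteq> t \<and> norm (y - t) < Min {d1, d2, t - l, h - t}"
        then have y: "y \<noteq> t" "\<bar>y - t\<bar> < d1" "\<bar>y - t\<bar> < d2" "l \<le> y" "y \<le> h"
          by auto
        show "norm ((F y - F t) / (y - t) - g t) < e"
        proof (cases "t < y")
          case True
          then show ?thesis using d1(2)[of "y - t"] y F[of t y] t by simp
        next
          case False
          with y have "y < t" by simp
          \<comment> \<open>Reflection turns the average over the interval to the right of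
            \<open>- t\<close> into the average of \<open>g\<close> over
            \<open>{y..t}\<close>.\<close>
          then have "\<bar>integral {- t..- y} (\<lambda>x. g (- x)) / (t - y) - g t\<bar> < e"
            using d2(2)[of "t - y"] y by simp
          then have "\<bar>(F t - F y) / (t - y) - g t\<bar> < e"
            using F[of y t] y t \<open>y < t\<close> by simp
          moreover have "(F t - F y) / (t - y) = (F y - F t) / (y - t)"
            using \<open>y < t\<close> by (simp add: field_simps)
          ultimately show ?thesis by simp
        qed
      qed
    qed
  qed
qed

text \<open>A convex set of reals has at most two points outside its interior, namely its infimum
  and its supremum.\<close>

lemma convex_real_borel: 
  fixes C :: "real set" assumes "convex C" shows "C \<in> sets borel"
proof -
  have 1: "C = interior C \<union> (C - interior C)" using interior_subset by auto
  have f: "finite (C - interior C)"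
  proof -
    have "C - interior C \<subseteq> {Inf C, Sup C}"
    proof
      fix x assume x: "x \<in> C - interior C"
      have "(\<forall>y\<in>C. x \<le> y) \<or> (\<forall>y\<in>C. y \<le> x)"
      proof (rule ccontr)
        assume "\<not> ?thesis"
        then obtain u v where uv: "u \<in> C" "v \<in> C" "u < x" "x < v" by (auto simp: not_le)
        have "{u<..<v} \<subseteq> C"
          using mem_is_interval_1_I[of C u v] assms uv by (auto simp: is_interval_convex_1)
        then have "x \<in> interior C" using uv by (auto intro!: interiorI[of "{u<..<v}"])
        then show False using x by simp
      qed
      then show "x \<in> {Inf C, Sup C}"
        using x cInf_eq_minimum[of x C] cSup_eq_maximum[of x C] by auto
    qed
    then show ?thesis by (rule finite_subset) simp
  qed
  show ?thesis by (subst 1, rule sets.Un) (use f in \<open>auto intro: borel_closed finite_imp_closed\<close>)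
qed

lemma convex_real_Icc_subset:
  fixes C :: "real set"
  shows "convex C \<Longrightarrow> u \<in> C \<Longrightarrow> v \<in> C \<Longrightarrow> {u..v} \<subseteq> C"
  using mem_is_interval_1_I[of C u v] by (auto simp: is_interval_convex_1)

text \<open>
  The step points to the left where a step to the right would leave \<open>C\<close>, so that the one-sided
  derivative is obtained at the maximum of \<open>C\<close>. Factoring through \<open>indicator C\<close> and \<open>lim\<close>
  makes this a Borel function although \<open>M\<close> need not be differentiable everywhere.
\<close>

definition slope_step :: "real set \<Rightarrow> nat \<Rightarrow> real \<Rightarrow> real" where
  "slope_step C n t = (if t + inverse (Suc n) \<in> C then inverse (Suc n) else - inverse (Suc n))"

definition slope_density :: "real set \<Rightarrow> (real \<Rightarrow> real) \<Rightarrow> real \<Rightarrow> real" where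
  "slope_density C M t = max 0 (lim (\<lambda>n.
     (indicator C (t + slope_step C n t) * M (t + slope_step C n t) - indicator C t * M t)
       / slope_step C n t))"

lemma slope_density_nonneg: "0 \<le> slope_density C M t"
  by (simp add: slope_density_def)

lemma borel_measurable_slope_density:
  assumes "convex C" "continuous_on C M"
  shows "slope_density C M \<in> borel_measurable borel"
proof -
  have C: "C \<in> sets borel" using assms(1) by (rule convex_real_borel)
  then have [measurable]: "(\<lambda>x. indicator C x * M x) \<in> borel_measurable borel"
    using borel_measurable_continuous_on_indicator[OF C assms(2)] by simp
  have [measurable]: "Measurable.pred borel (\<lambda>t. t + inverse (real (Suc n)) \<in> C)" for n
    using C by measurable
  have [measurable]: "slope_step C n \<in> borel_measurable borel" for n
    unfolding slope_step_def[abs_def] by measurable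
  have "(\<lambda>t. indicator C (t + slope_step C n t) * M (t + slope_step C n t)) \<in> borel_measurable borel" for n
    by (rule measurable_compose[of "\<lambda>t. t + slope_step C n t" borel borel "\<lambda>x. indicator C x * M x"]) measurable
  note [measurable] = this
  show ?thesis unfolding slope_density_def[abs_def] by measurable
qed

text \<open>The points \<open>t + slope_step C n t\<close> tend to \<open>t\<close> and eventually
  stay in \<open>C\<close>, so the quotients in the definition converge to \<open>D\<close>.
  Monotonicity gives \<open>0 \<le> D\<close>, hence the maximum with 0 changes nothing. The second
  point \<open>s\<close> of \<open>C\<close> leaves room for steps on at least one side of
  \<open>t\<close>.\<close>

lemma slope_density_eq:
  assumes "convex C" and mono: "mono_on C M" and t: "t \<in> C" and s: "s \<in> C" "s \<noteq> t"
    and D: "(M has_real_derivative D) (at t within C)"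
  shows "slope_density C M t = D"
proof -
  define y where "y n = t + slope_step C n t" for n
  have inv: "(\<lambda>n. inverse (real (Suc n))) \<longlonglongrightarrow> 0" by (rule LIMSEQ_inverse_real_of_nat)
  have "(\<lambda>n. slope_step C n t) \<longlonglongrightarrow> 0"
    by (rule tendsto_rabs_zero_cancel) (use inv in \<open>simp add: slope_step_def if_distrib cong: if_cong\<close>)
  then have yt: "y \<longlonglongrightarrow> t" unfolding y_def using tendsto_add[OF tendsto_const, of _ 0 sequentially t] by simp
  have yne: "y n \<noteq> t" for n by (auto simp: y_def slope_step_def)
  \<comment> \<open>Once the step is shorter than the distance to \<open>s\<close>, the step towards
    \<open>s\<close> stays in \<open>C\<close> by convexity. If \<open>s\<close> lies to the left, a
    step to the right is taken only when it too stays in \<open>C\<close>.\<close>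
  have ev: "\<forall>\<^sub>F n in sequentially. inverse (real (Suc n)) < \<bar>s - t\<bar>"
    using order_tendstoD(2)[OF inv, of "\<bar>s - t\<bar>"] s by simp
  have yC: "\<forall>\<^sub>F n in sequentially. y n \<in> C"
    using ev
  proof (rule eventually_mono)
    fix n assume n: "inverse (real (Suc n)) < \<bar>s - t\<bar>"
    show "y n \<in> C"
    proof (cases "t < s")
      case True
      then have "t + inverse (real (Suc n)) \<in> {t..s}" using n by simp
      then have "t + inverse (real (Suc n)) \<in> C" using convex_real_Icc_subset[OF \<open>convex C\<close> t s(1)] by blast
      then show ?thesis by (simp add: y_def slope_step_def)
    next
      case False
      then have "t - inverse (real (Suc n)) \<in> {s..t}" using n s by simp
      then have "t - inverse (real (Suc n)) \<in> C" using convex_real_Icc_subset[OF \<open>convex C\<close> s(1) t] by blast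
      then show ?thesis by (auto simp: y_def slope_step_def)
    qed
  qed
  have "filterlim y (at t within C) sequentially"
    unfolding filterlim_at using yt yC yne by (auto elim: eventually_mono)
  then have lim: "(\<lambda>n. (M (y n) - M t) / (y n - t)) \<longlonglongrightarrow> D"
    using D unfolding has_field_derivative_iff by (rule filterlim_compose[rotated])
  have nonneg: "\<forall>\<^sub>F n in sequentially. 0 \<le> (M (y n) - M t) / (y n - t)"
    using yC
  proof (rule eventually_mono)
    fix n assume "y n \<in> C"
    then show "0 \<le> (M (y n) - M t) / (y n - t)"
      using mono_onD[OF mono, of t "y n"] mono_onD[OF mono, of "y n" t] t
      by (cases "t \<le> y n") (auto simp: zero_le_divide_iff)
  qed
  have "0 \<le> D" by (rule tendsto_lowerbound[OF lim nonneg]) simp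
  have "(\<lambda>n. (indicator C (y n) * M (y n) - indicator C t * M t) / slope_step C n t) \<longlonglongrightarrow> D"
    by (rule Lim_transform_eventually[OF lim])
       (use yC in eventually_elim, use t in \<open>simp add: y_def\<close>)
  then have "lim (\<lambda>n. (indicator C (y n) * M (y n) - indicator C t * M t) / slope_step C n t) = D"
    by (rule limI)
  then show ?thesis using \<open>0 \<le> D\<close> by (simp add: slope_density_def y_def)
qed

text \<open>The Radon-Nikodym density of \<open>M\<close> on \<open>{x..y}\<close> is the derivative
  of \<open>M\<close> almost everywhere, and so is \<open>slope_density C M\<close>. The two
  functions therefore agree almost everywhere, and the integrals carry over to a function that is
  independent of the interval.\<close>

lemma
  assumes C: "convex C" and AC: "absolutely_continuous_on C M" and mono: "mono_on C M"
    and xy: "x \<in> C" "y \<in> C" "x < y"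
  shows AE_slope_density: "AE t in lborel. t \<in> {x<..<y} \<longrightarrow> (M has_real_derivative slope_density C M t) (at t)"
    and set_integrable_slope_density: "set_integrable lborel {x..y} (slope_density C M)"
    and set_integral_slope_density: "(LBINT t:{x..y}. slope_density C M t) = M y - M x"
proof -
  have sub: "{x..y} \<subseteq> C" using convex_real_Icc_subset[OF C] xy by simp
  obtain g where g: "integrable lborel g"
    "\<And>u v. x \<le> u \<Longrightarrow> u \<le> v \<Longrightarrow> v \<le> y \<Longrightarrow> (LBINT t:{u..v}. g t) = M v - M u"
    using mono_absolutely_continuous_density[OF absolutely_continuous_on_subset[OF AC sub]
        mono_on_subset[OF mono sub] xy(3)] by metis
  have [measurable]: "g \<in> borel_measurable borel" using g(1) by auto
  have gi: "set_integrable lborel {u..v} g" for u v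
    unfolding set_integrable_def by (rule integrable_mult_indicator[OF _ g(1)]) simp
  have "AE t in lborel. t \<in> {x<..<y} \<longrightarrow> (M has_real_derivative g t) (at t)"
    by (rule AE_has_real_derivative_indefinite_integral)
       (use gi g(2) in \<open>auto simp: set_borel_integral_eq_integral\<close>)
  then have both: "AE t in lborel. t \<in> {x<..<y} \<longrightarrow>
      (M has_real_derivative slope_density C M t) (at t) \<and> slope_density C M t = g t"
  proof (rule eventually_mono, intro impI)
    fix t assume *: "t \<in> {x<..<y} \<longrightarrow> (M has_real_derivative g t) (at t)" "t \<in> {x<..<y}"
    then have d: "(M has_real_derivative g t) (at t)" by simp
    moreover have "slope_density C M t = g t"
      using * sub xy by (intro slope_density_eq[OF C mono _ xy(1) _ has_field_derivative_at_within[OF d]]) auto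
    ultimately show "(M has_real_derivative slope_density C M t) (at t) \<and> slope_density C M t = g t"
      by simp
  qed
  then show "AE t in lborel. t \<in> {x<..<y} \<longrightarrow> (M has_real_derivative slope_density C M t) (at t)"
    by (auto elim: eventually_mono)
  have [measurable]: "slope_density C M \<in> borel_measurable borel"
    by (rule borel_measurable_slope_density[OF C absolutely_continuous_on_imp_continuous_on[OF AC]])
  have ae: "AE t in lborel. indicator {x..y} t *\<^sub>R g t = indicator {x..y} t *\<^sub>R slope_density C M t"
    using both AE_lborel_singleton[of x] AE_lborel_singleton[of y]
    by eventually_elim (auto simp: indicator_def)
  show "set_integrable lborel {x..y} (slope_density C M)"
    using gi[of x y] unfolding set_integrable_def
    by (rule integrable_cong_AE_imp) (use ae in \<open>auto elim: eventually_mono\<close>)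
  have "(LBINT t:{x..y}. slope_density C M t) = (LBINT t:{x..y}. g t)"
    unfolding set_lebesgue_integral_def using ae by (intro integral_cong_AE) (auto elim: eventually_mono)
  then show "(LBINT t:{x..y}. slope_density C M t) = M y - M x"
    using g(2)[of x y] xy by simp
qed

text \<open>Countably many open intervals with rational end points in \<open>C\<close> cover the
  interior of \<open>C\<close>, and the frontier of a convex set is negligible. So the exceptional
  null sets of the single intervals can be united.\<close>

lemma AE_differentiable_mono_absolutely_continuous:
  assumes C: "convex C" and AC: "absolutely_continuous_on C M" and mono: "mono_on C M"
  shows "AE t in lborel. t \<in> C \<longrightarrow> (\<exists>D. (M has_real_derivative D) (at t))"
proof -
  define Q where "Q = {(p, q). p \<in> \<rat> \<and> q \<in> \<rat> \<and> p < q \<and> p \<in> C \<and> q \<in> C}"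
  have "Q \<subseteq> \<rat> \<times> \<rat>" by (auto simp: Q_def)
  then have "countable Q" by (rule countable_subset) (simp add: countable_rat)
  moreover have "AE t in lborel. t \<in> {p<..<q} \<longrightarrow> (\<exists>D. (M has_real_derivative D) (at t))"
    if "(p, q) \<in> Q" for p q
    using AE_slope_density[OF C AC mono, of p q] that by (auto simp: Q_def elim: eventually_mono)
  ultimately have 1: "AE t in lborel. \<forall>(p, q)\<in>Q. t \<in> {p<..<q} \<longrightarrow> (\<exists>D. (M has_real_derivative D) (at t))"
    by (subst AE_ball_countable) auto
  have 2: "AE t in lborel. t \<notin> frontier C"
    by (rule negligible_AE_lborel[OF negligible_convex_frontier[OF C]])
  show ?thesis using 1 2
  proof eventually_elim
    fix t assume *: "\<forall>(p, q)\<in>Q. t \<in> {p<..<q} \<longrightarrow> (\<exists>D. (M has_real_derivative D) (at t))" "t \<notin> frontier C"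
    show "t \<in> C \<longrightarrow> (\<exists>D. (M has_real_derivative D) (at t))"
    proof
      assume "t \<in> C"
      then have "t \<in> interior C" using *(2) closure_subset by (auto simp: frontier_def)
      then obtain e where e: "e > 0" "ball t e \<subseteq> C" by (auto simp: mem_interior)
      obtain p where p: "p \<in> \<rat>" "t - e < p" "p < t" using Rats_dense_in_real[of "t - e" t] e by auto
      obtain q where q: "q \<in> \<rat>" "t < q" "q < t + e" using Rats_dense_in_real[of t "t + e"] e by auto
      have "p \<in> ball t e" "q \<in> ball t e" using p q by (auto simp: dist_real_def)
      then have "(p, q) \<in> Q" using p q e by (auto simp: Q_def)
      then show "\<exists>D. (M has_real_derivative D) (at t)" using * p q by fastforce
    qed
  qed
qed

section \<open>Propriety for two-point probabilities\<close>

text \<open>The difference quotients of \<open>J\<close> are bounded by \<open>w\<close>, so the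
  derivative of \<open>J\<close> is 0 throughout the convex set. In the applications
  \<open>w\<close> is built from increments of continuous functions.\<close>

lemma constant_on_if_superlinear_increments:
  fixes J :: "real \<Rightarrow> real"
  assumes "convex S" "t \<in> S" "x \<in> S"
    and bound: "\<And>x t. x \<in> S \<Longrightarrow> t \<in> S \<Longrightarrow> \<bar>J x - J t\<bar> \<le> \<bar>x - t\<bar> * w t x"
    and w: "\<And>t. t \<in> S \<Longrightarrow> (w t \<longlongrightarrow> 0) (at t within S)"
  shows "J x = J t"
proof -
  have "(J has_real_derivative 0) (at t within S)" if "t \<in> S" for t
    unfolding has_field_derivative_iff
  proof (rule Lim_null_comparison[OF _ w[OF that]])
    show "\<forall>\<^sub>F x in at t within S. norm ((J x - J t) / (x - t)) \<le> w t x"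
      unfolding eventually_at_filter
      using bound that by (auto intro!: always_eventually simp: abs_divide field_simps)
  qed
  then obtain c where "\<forall>x\<in>S. J x = c"
    using has_field_derivative_zero_constant[OF \<open>convex S\<close>, of J] by blast
  then show ?thesis using assms by simp
qed

text \<open>
  The inequality into which propriety for two-point probabilities translates. Exchanging \<open>x\<close> and
  \<open>t\<close> gives a lower bound as well, so that \<open>f\<close> is an antiderivative of \<open>(k - t) dM(t)\<close> in the
  sense of Riemann-Stieltjes.
\<close>

definition stieltjes_bound :: "real \<Rightarrow> (real \<Rightarrow> real) \<Rightarrow> (real \<Rightarrow> real) \<Rightarrow> real set \<Rightarrow> bool" where
  "stieltjes_bound k f M T \<longleftrightarrow> (\<forall>x\<in>T. \<forall>t\<in>T. f x - f t \<le> (k - t) * (M x - M t))"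

lemma stieltjes_boundD:
  "stieltjes_bound k f M T \<Longrightarrow> x \<in> T \<Longrightarrow> t \<in> T \<Longrightarrow> f x - f t \<le> (k - t) * (M x - M t)"
  by (simp add: stieltjes_bound_def)

lemma stieltjes_bound_subset:
  "stieltjes_bound k f M T \<Longrightarrow> S \<subseteq> T \<Longrightarrow> stieltjes_bound k f M S"
  unfolding stieltjes_bound_def by blast

text \<open>Adding the bound for \<open>x, t\<close> to the bound for \<open>t, x\<close> eliminates
  \<open>f\<close> and leaves \<open>0 \<le> (x - t) * (M x - M t)\<close>.\<close>

lemma stieltjes_bound_mono_on:
  assumes "stieltjes_bound k f M T"
  shows "mono_on T M"
proof (rule mono_onI)
  fix t x assume "t \<in> T" "x \<in> T" "t \<le> x"
  then have "0 \<le> (x - t) * (M x - M t)"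
    using stieltjes_boundD[OF assms, of x t] stieltjes_boundD[OF assms, of t x] by (simp add: algebra_simps)
  then show "M t \<le> M x" using \<open>t \<le> x\<close> by (cases "t = x") (auto simp: zero_le_mult_iff)
qed

text \<open>The bound with \<open>x\<close> and \<open>t\<close> exchanged is a lower bound with
  weight \<open>k - x\<close> in place of \<open>k - t\<close>; the gap between the two is
  \<open>(t - x) * (M x - M t)\<close>.\<close>

lemma stieltjes_bound_abs:
  assumes "stieltjes_bound k f M T" "x \<in> T" "t \<in> T"
  shows "\<bar>f x - f t - (k - t) * (M x - M t)\<bar> \<le> \<bar>x - t\<bar> * \<bar>M x - M t\<bar>"
proof -
  have "f x - f t - (k - t) * (M x - M t) \<le> 0" "(t - x) * (M x - M t) \<le> f x - f t - (k - t) * (M x - M t)"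
    using stieltjes_boundD[OF assms] stieltjes_boundD[OF assms(1,3,2)] by (simp_all add: algebra_simps)
  then have "\<bar>f x - f t - (k - t) * (M x - M t)\<bar> \<le> \<bar>(t - x) * (M x - M t)\<bar>" by linarith
  then show ?thesis by (simp add: abs_mult abs_minus_commute)
qed

section \<open>Differentiation, uniqueness and integration under a Stieltjes bound\<close>

lemma tendsto_increment_zero:
  fixes M :: "real \<Rightarrow> real"
  assumes "continuous_on T M" "t \<in> T"
  shows "((\<lambda>x. \<bar>M x - M t\<bar>) \<longlongrightarrow> 0) (at t within T)"
proof -
  have "(M \<longlongrightarrow> M t) (at t within T)" using assms by (simp add: continuous_on_def)
  then have "((\<lambda>x. M x - M t) \<longlongrightarrow> 0) (at t within T)" by (simp add: LIM_zero)
  then show ?thesis by (rule tendsto_rabs_zero)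
qed

text \<open>Dividing the error estimate by \<open>\<bar>x - t\<bar>\<close> leaves
  \<open>\<bar>M x - M t\<bar>\<close>, which tends to 0 by continuity. Differentiability can
  therefore be transferred between \<open>f\<close> and \<open>M\<close> in both directions.\<close>

lemma stieltjes_bound_slopes:
  assumes "stieltjes_bound k f M T" "continuous_on T M" "t \<in> T"
  shows "((\<lambda>x. (f x - f t) / (x - t) - (k - t) * ((M x - M t) / (x - t))) \<longlongrightarrow> 0) (at t within T)"
proof (rule Lim_null_comparison[OF _ tendsto_increment_zero[OF assms(2,3)]])
  show "\<forall>\<^sub>F x in at t within T.
      norm ((f x - f t) / (x - t) - (k - t) * ((M x - M t) / (x - t))) \<le> \<bar>M x - M t\<bar>"
    unfolding eventually_at_filter
  proof (intro always_eventually allI impI)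
    fix x assume x: "x \<noteq> t" "x \<in> T"
    have "(f x - f t) / (x - t) - (k - t) * ((M x - M t) / (x - t))
        = (f x - f t - (k - t) * (M x - M t)) / (x - t)"
      by (metis diff_divide_distrib times_divide_eq_right)
    then show "norm ((f x - f t) / (x - t) - (k - t) * ((M x - M t) / (x - t))) \<le> \<bar>M x - M t\<bar>"
      using stieltjes_bound_abs[OF assms(1) x(2) assms(3)] x
      by (simp add: abs_divide divide_le_eq mult.commute)
  qed
qed

lemma stieltjes_bound_has_derivative:
  assumes "stieltjes_bound k f M T" "continuous_on T M" "t \<in> T"
    and "(M has_real_derivative D) (at t within T)"
  shows "(f has_real_derivative (k - t) * D) (at t within T)"
  using tendsto_add[OF stieltjes_bound_slopes[OF assms(1-3)]
    tendsto_mult_left[OF assms(4)[unfolded has_field_derivative_iff], of "k - t"]]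
  by (simp add: has_field_derivative_iff)

text \<open>This direction yields the formula for the density at every \<open>t \<noteq> k\<close>
  where the score is differentiable, not merely almost everywhere.\<close>

lemma stieltjes_bound_has_derivative_rev:
  assumes "stieltjes_bound k f M T" "continuous_on T M" "t \<in> T" "t \<noteq> k"
    and "(f has_real_derivative D) (at t within T)"
  shows "(M has_real_derivative D / (k - t)) (at t within T)"
  using tendsto_divide[OF tendsto_diff[OF assms(5)[unfolded has_field_derivative_iff]
    stieltjes_bound_slopes[OF assms(1-3)]] tendsto_const[of "k - t"]] assms(4)
  by (simp add: has_field_derivative_iff)

text \<open>Subtracting the two estimates cancels \<open>f\<close>, so \<open>(k - t)\<close> times
  the increment of \<open>M - M'\<close> is superlinear. Division by
  \<open>\<bar>k - t\<bar>\<close>, possible because \<open>k \<notin> T\<close>, makes the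
  increment itself superlinear.\<close>

lemma stieltjes_bound_unique:
  assumes MM: "stieltjes_bound k f M T" "stieltjes_bound k f M' T"
    and cont: "continuous_on T M" "continuous_on T M'" and T: "convex T" "k \<notin> T" "x \<in> T" "t \<in> T"
  shows "M x - M' x = M t - M' t"
proof (rule constant_on_if_superlinear_increments[OF T(1,4,3),
    where J = "\<lambda>x. M x - M' x" and w = "\<lambda>t x. (\<bar>M x - M t\<bar> + \<bar>M' x - M' t\<bar>) / \<bar>k - t\<bar>"])
  fix x t assume xt: "x \<in> T" "t \<in> T"
  then have "k \<noteq> t" using T by auto
  have "(k - t) * ((M x - M' x) - (M t - M' t)) = (k - t) * (M x - M t) - (k - t) * (M' x - M' t)"
    by (simp add: algebra_simps)
  then have "\<bar>(k - t) * ((M x - M' x) - (M t - M' t))\<bar> \<le> \<bar>x - t\<bar> * \<bar>M x - M t\<bar> + \<bar>x - t\<bar> * \<bar>M' x - M' t\<bar>"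
    using stieltjes_bound_abs[OF MM(1) xt] stieltjes_bound_abs[OF MM(2) xt] by linarith
  then have "\<bar>k - t\<bar> * \<bar>(M x - M' x) - (M t - M' t)\<bar> \<le> \<bar>x - t\<bar> * (\<bar>M x - M t\<bar> + \<bar>M' x - M' t\<bar>)"
    by (simp only: abs_mult distrib_left)
  then show "\<bar>(M x - M' x) - (M t - M' t)\<bar> \<le> \<bar>x - t\<bar> * ((\<bar>M x - M t\<bar> + \<bar>M' x - M' t\<bar>) / \<bar>k - t\<bar>)"
    using \<open>k \<noteq> t\<close> by (simp add: pos_le_divide_eq mult.commute)
next
  fix t assume "t \<in> T"
  show "((\<lambda>x. (\<bar>M x - M t\<bar> + \<bar>M' x - M' t\<bar>) / \<bar>k - t\<bar>) \<longlongrightarrow> 0) (at t within T)"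
    using tendsto_divide_zero[OF tendsto_add_zero[OF tendsto_increment_zero[OF cont(1) \<open>t \<in> T\<close>]
      tendsto_increment_zero[OF cont(2) \<open>t \<in> T\<close>]], of "\<bar>k - t\<bar>"] by simp
qed

text \<open>On \<open>{u..v}\<close> the weight \<open>k - t\<close> lies between
  \<open>k - v\<close> and \<open>k - u\<close>, so the integral obeys the same two bounds as
  \<open>f v - f u\<close>. The difference of \<open>f\<close> and the indefinite integral then has
  superlinear increments and is constant.\<close>

lemma set_integral_weighted_slope_density:
  assumes C: "convex C" and AC: "absolutely_continuous_on C M"
    and bound: "stieltjes_bound k f M C" and xy: "x \<in> C" "y \<in> C" "x < y"
  shows "set_integrable lborel {x..y} (\<lambda>t. (k - t) * slope_density C M t)"
    and "(LBINT t:{x..y}. (k - t) * slope_density C M t) = f y - f x"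
proof -
  let ?m = "slope_density C M"
  have mono: "mono_on C M" by (rule stieltjes_bound_mono_on[OF bound])
  have cont: "continuous_on C M" by (rule absolutely_continuous_on_imp_continuous_on[OF AC])
  have [measurable]: "?m \<in> borel_measurable borel" by (rule borel_measurable_slope_density[OF C cont])
  have sub: "{x..y} \<subseteq> C" using convex_real_Icc_subset[OF C] xy by simp
  have int: "set_integrable lborel {u..v} (\<lambda>t. (k - t) * ?m t)"
    if "u \<in> C" "v \<in> C" "u < v" for u v
  proof (rule set_integrable_bound)
    \<comment> \<open>On \<open>{u..v}\<close> the weight is at most
      \<open>\<bar>k - u\<bar> + \<bar>k - v\<bar>\<close> in absolute value, wherever
      \<open>k\<close> lies.\<close>
    show "set_integrable lborel {u..v} (\<lambda>t. (\<bar>k - u\<bar> + \<bar>k - v\<bar>) * ?m t)"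
      using set_integrable_slope_density[OF C AC mono that] by simp
    show "set_borel_measurable lborel {u..v} (\<lambda>t. (k - t) * ?m t)"
      unfolding set_borel_measurable_def by measurable
    show "AE t in lborel. t \<in> {u..v} \<longrightarrow> norm ((k - t) * ?m t) \<le> norm ((\<bar>k - u\<bar> + \<bar>k - v\<bar>) * ?m t)"
      using slope_density_nonneg[of C M]
      by (intro AE_I2) (auto simp: abs_mult intro!: mult_right_mono)
  qed
  show "set_integrable lborel {x..y} (\<lambda>t. (k - t) * ?m t)" by (rule int[OF xy])
  have diff: "\<bar>f v - f u - (LBINT t:{u..v}. (k - t) * ?m t)\<bar> \<le> (v - u) * \<bar>M v - M u\<bar>"
    if uv: "u \<in> C" "v \<in> C" "u < v" for u v
  proof -
    note m = set_integrable_slope_density[OF C AC mono uv] set_integral_slope_density[OF C AC mono uv]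
    have "(LBINT t:{u..v}. (k - v) * ?m t) \<le> (LBINT t:{u..v}. (k - t) * ?m t)"
      using m(1) by (intro set_integral_mono int uv)
        (auto intro!: mult_right_mono slope_density_nonneg)
    moreover have "(LBINT t:{u..v}. (k - t) * ?m t) \<le> (LBINT t:{u..v}. (k - u) * ?m t)"
      using m(1) by (intro set_integral_mono int uv)
        (auto intro!: mult_right_mono slope_density_nonneg)
    ultimately have I: "(k - v) * (M v - M u) \<le> (LBINT t:{u..v}. (k - t) * ?m t)"
      "(LBINT t:{u..v}. (k - t) * ?m t) \<le> (k - u) * (M v - M u)"
      using m(2) by simp_all
    have "M u \<le> M v" using mono_onD[OF mono] uv by simp
    then show ?thesis
      using I stieltjes_boundD[OF bound uv(2,1)] stieltjes_boundD[OF bound uv(1,2)]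
      by (simp add: abs_le_iff algebra_simps)
  qed
  define J where "J u = f u - (LBINT t:{x..u}. (k - t) * ?m t)" for u
  have J: "J v - J u = f v - f u - (LBINT t:{u..v}. (k - t) * ?m t)"
    if "x \<le> u" "u < v" "v \<le> y" for u v
  proof -
    have "(LBINT t=x..u. (k - t) * ?m t) + (LBINT t=u..v. (k - t) * ?m t) = (LBINT t=x..v. (k - t) * ?m t)"
    proof (rule interval_integral_sum)
      have "set_integrable lborel {x..v} (\<lambda>t. (k - t) * ?m t)"
        using that sub xy by (intro int) auto
      then have "set_integrable lborel {x<..<v} (\<lambda>t. (k - t) * ?m t)"
        by (rule set_integrable_subset) auto
      then show "interval_lebesgue_integrable lborel (min (ereal x) (min (ereal u) (ereal v)))
          (max (ereal x) (max (ereal u) (ereal v))) (\<lambda>t. (k - t) * ?m t)"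
        using that by (simp add: interval_lebesgue_integrable_def min_def max_def)
    qed
    then show ?thesis using that by (simp add: J_def interval_integral_Icc)
  qed
  have "J y = J x"
  proof (rule constant_on_if_superlinear_increments[where J = J and S = "{x..y}" and w = "\<lambda>t x. \<bar>M x - M t\<bar>"])
    fix u v assume uv: "u \<in> {x..y}" "v \<in> {x..y}"
    then have "u \<in> C" "v \<in> C" using sub by auto
    then show "\<bar>J u - J v\<bar> \<le> \<bar>u - v\<bar> * \<bar>M u - M v\<bar>"
      using J[of u v] J[of v u] diff[of u v] diff[of v u] uv
      by (cases u v rule: linorder_cases) (auto simp: abs_minus_commute)
  next
    fix t assume "t \<in> {x..y}"
    then show "((\<lambda>x. \<bar>M x - M t\<bar>) \<longlongrightarrow> 0) (at t within {x..y})"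
      by (intro tendsto_increment_zero continuous_on_subset[OF cont sub])
  qed (use xy in auto)
  moreover have "(LBINT t:{x..x}. (k - t) * ?m t) = 0"
    using interval_integral_Icc[of x x "\<lambda>t. (k - t) * ?m t"] by simp
  ultimately show "(LBINT t:{x..y}. (k - t) * ?m t) = f y - f x" by (simp add: J_def)
qed

section \<open>Integral representation, derivative formula and strict positivity\<close>

lemma stieltjes_bound_integral_representation:
  assumes C: "convex C" and AC: "absolutely_continuous_on C M"
    and bound: "\<And>k. k \<in> R \<Longrightarrow> stieltjes_bound k (a k) M C" and "R \<subseteq> C"
  shows "integral_representation R C a (slope_density C M)"
  unfolding integral_representation_def
proof (intro ballI)
  fix k x assume kx: "k \<in> R" "x \<in> C"
  then have "k \<in> C" using \<open>R \<subseteq> C\<close> by auto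
  let ?g = "\<lambda>t. (k - t) * slope_density C M t"
  have Icc: "interval_lebesgue_integrable lborel (ereal u) (ereal v) ?g \<and>
      (LBINT t=ereal u..ereal v. ?g t) = a k v - a k u" if "u \<in> C" "v \<in> C" "u < v" for u v
  proof -
    note I = set_integral_weighted_slope_density[OF C AC bound[OF kx(1)] that]
    have "set_integrable lborel {u<..<v} ?g" by (rule set_integrable_subset[OF I(1)]) auto
    then show ?thesis
      using that I(2) by (simp add: interval_lebesgue_integrable_def interval_integral_Icc)
  qed
  show "interval_lebesgue_integrable lborel (ereal x) (ereal k) ?g \<and>
      a k x = a k k - (LBINT t=ereal x..ereal k. ?g t)"
  proof (cases x k rule: linorder_cases)
    case less
    then show ?thesis using Icc[of x k] kx \<open>k \<in> C\<close> by simp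
  next
    case equal
    then show ?thesis by (simp add: interval_lebesgue_integrable_def set_integrable_def)
  next
    case greater
    then show ?thesis using Icc[of k x] kx \<open>k \<in> C\<close>
      by (subst interval_integrable_endpoints_reverse, subst interval_integral_endpoints_reverse) simp
  qed
qed

text \<open>Differentiability almost everywhere passes from \<open>M\<close> to \<open>a k\<close>;
  the formula at a given point passes back from \<open>a k\<close> to \<open>M\<close>.\<close>

lemma stieltjes_bound_derivative_formula:
  assumes C: "convex C" and AC: "absolutely_continuous_on C M"
    and bound: "\<And>k. k \<in> R \<Longrightarrow> stieltjes_bound k (a k) M C" and "R \<subseteq> C"
  shows "derivative_formula R C a (slope_density C M)"
  unfolding derivative_formula_def
proof (intro ballI conjI allI impI)
  fix k assume k: "k \<in> R"
  have mono: "mono_on C M" by (rule stieltjes_bound_mono_on[OF bound[OF k]])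
  have cont: "continuous_on C M" by (rule absolutely_continuous_on_imp_continuous_on[OF AC])
  show "AE t\<in>C in lborel. a k differentiable (at t within C)"
    using AE_differentiable_mono_absolutely_continuous[OF C AC mono]
  proof (rule eventually_mono, intro impI)
    fix t assume "t \<in> C \<longrightarrow> (\<exists>D. (M has_real_derivative D) (at t))" "t \<in> C"
    then obtain D where "(M has_real_derivative D) (at t within C)"
      using has_field_derivative_at_within by blast
    then have "(a k has_real_derivative (k - t) * D) (at t within C)"
      by (rule stieltjes_bound_has_derivative[OF bound[OF k] cont \<open>t \<in> C\<close>])
    then show "a k differentiable (at t within C)" by (auto simp: real_differentiable_def)
  qed
  fix t D assume t: "t \<in> C - {k}" and D: "(a k has_real_derivative D) (at t within C)"
  have "(M has_real_derivative D / (k - t)) (at t within C)"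
    using t by (intro stieltjes_bound_has_derivative_rev[OF bound[OF k] cont _ _ D]) auto
  \<comment> \<open>The value \<open>k\<close> itself is the second point of \<open>C\<close> that
    \<open>slope_density_eq\<close> asks for.\<close>
  then show "slope_density C M t = D / (k - t)"
    using t k \<open>R \<subseteq> C\<close> by (intro slope_density_eq[OF C mono, of _ k]) auto
qed

text \<open>If the density were positive only on a null subset of \<open>{u<..<v}\<close>, its
  integral \<open>M v - M u\<close> would be 0.\<close>

lemma strictly_positive_on_slope_density:
  assumes C: "convex C" and AC: "absolutely_continuous_on C M" and mono: "strict_mono_on C M"
  shows "strictly_positive_on C (slope_density C M)"
  unfolding strictly_positive_on_def positive_on_def
proof (intro conjI ballI impI slope_density_nonneg)
  fix u v assume uv: "u \<in> C" "v \<in> C" "u < v"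
  let ?m = "slope_density C M"
  have monoM: "mono_on C M" using mono by (rule strict_mono_on_imp_mono_on)
  have [measurable]: "?m \<in> borel_measurable borel"
    by (rule borel_measurable_slope_density[OF C absolutely_continuous_on_imp_continuous_on[OF AC]])
  show "0 < emeasure lborel {t \<in> {u<..<v}. 0 < ?m t}"
  proof (rule ccontr)
    assume "\<not> ?thesis"
    then have "{t \<in> {u<..<v}. 0 < ?m t} \<in> null_sets lborel" by (auto simp: null_sets_def)
    then have "AE t in lborel. t \<notin> {t \<in> {u<..<v}. 0 < ?m t}" by (rule AE_not_in)
    then have "AE t in lborel. indicator {u..v} t *\<^sub>R ?m t = 0"
      using AE_lborel_singleton[of u] AE_lborel_singleton[of v]
    proof eventually_elim
      case (elim t)
      then show ?case using slope_density_nonneg[of C M t] by (auto simp: indicator_def)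
    qed
    then have "(LBINT t:{u..v}. ?m t) = 0"
      unfolding set_lebesgue_integral_def by (rule integral_eq_zero_AE)
    moreover have "M u < M v" using strict_mono_onD[OF mono] uv by blast
    ultimately show False using set_integral_slope_density[OF C AC monoM uv] by simp
  qed
qed

text \<open>Uniqueness on the open interval extends to the closed one by continuity. This admits
  \<open>k\<close> as an end point, the case that arises when slopes of different pairs are
  compared.\<close>

lemma stieltjes_bound_unique_Icc:
  assumes MM: "stieltjes_bound k f M {u..v}" "stieltjes_bound k f M' {u..v}"
    and cont: "continuous_on {u..v} M" "continuous_on {u..v} M'"
    and "u < v" "k \<notin> {u<..<v}"
  obtains c where "\<forall>x\<in>{u..v}. M x = M' x + c"
proof -
  let ?z = "(u + v) / 2" and ?T = "{u<..<v}"
  have sub: "?T \<subseteq> {u..v}" by auto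
  have z: "?z \<in> ?T" using \<open>u < v\<close> by auto
  have const: "M x - M' x = M ?z - M' ?z" if "x \<in> ?T" for x
    using \<open>k \<notin> ?T\<close> that z
    by (intro stieltjes_bound_unique[OF stieltjes_bound_subset[OF MM(1) sub] stieltjes_bound_subset[OF MM(2) sub]
          continuous_on_subset[OF cont(1) sub] continuous_on_subset[OF cont(2) sub]]) auto
  have cl: "closure ?T = {u..v}" using \<open>u < v\<close> by simp
  have "continuous_on (closure ?T) (\<lambda>x. M x - M' x)"
    unfolding cl by (intro continuous_intros cont)
  then have "M x - M' x = M ?z - M' ?z" if "x \<in> {u..v}" for x
    by (rule continuous_constant_on_closure[OF _ const]) (use that cl in simp_all)
  then show thesis by (intro that[of "M ?z - M' ?z"]) (simp add: algebra_simps)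
qed

text \<open>Since \<open>j - t = (k - t) + (j - k)\<close>, replacing the weight
  \<open>k - t\<close> by \<open>j - t\<close> amounts to adding \<open>(j - k) * M x\<close> to the
  antiderivative.\<close>

lemma stieltjes_bound_shift:
  assumes "stieltjes_bound k f M T" and g: "\<And>x. x \<in> T \<Longrightarrow> g x = f x + (j - k) * M x + c"
  shows "stieltjes_bound j g M T"
  unfolding stieltjes_bound_def
proof (intro ballI)
  fix x t assume "x \<in> T" "t \<in> T"
  have "g x - g t = (f x - f t) + (j - k) * (M x - M t)"
    using g[OF \<open>x \<in> T\<close>] g[OF \<open>t \<in> T\<close>] by (simp add: algebra_simps)
  also have "\<dots> \<le> (k - t) * (M x - M t) + (j - k) * (M x - M t)"
    using stieltjes_boundD[OF assms(1) \<open>x \<in> T\<close> \<open>t \<in> T\<close>] by simp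
  also have "\<dots> = (j - t) * (M x - M t)" by (simp add: algebra_simps)
  finally show "g x - g t \<le> (j - t) * (M x - M t)" .
qed

section \<open>One slope, up to constants, for all pairs of values\<close>

locale two_point_propriety =
  fixes R C :: "real set" and a :: "real \<Rightarrow> real \<Rightarrow> real"
  assumes hull: "C = convex hull R"
    and ac: "\<And>k. k \<in> R \<Longrightarrow> absolutely_continuous_on C (a k)"
    and two_point: "\<And>k r t x. \<lbrakk>k \<in> R; r \<in> R; k < t; t < r; x \<in> C\<rbrakk>
      \<Longrightarrow> (r - t) * a k x + (t - k) * a r x \<le> (r - t) * a k t + (t - k) * a r t"
begin

definition slope :: "real \<Rightarrow> real \<Rightarrow> real \<Rightarrow> real" where
  "slope k r x = (a r x - a k x) / (r - k)"

lemma slope_mult: "k \<noteq> r \<Longrightarrow> a r x = a k x + (r - k) * slope k r x"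
  by (simp add: slope_def)

lemma convex_C: "convex C"
  by (simp add: hull)

lemma R_subset_C: "R \<subseteq> C"
  by (simp add: hull hull_subset)

lemma Icc_subset_C: "k \<in> R \<Longrightarrow> r \<in> R \<Longrightarrow> {k..r} \<subseteq> C"
  using R_subset_C by (intro convex_real_Icc_subset[OF convex_C]) auto

lemma absolutely_continuous_slope:
  "k \<in> R \<Longrightarrow> r \<in> R \<Longrightarrow> k < r \<Longrightarrow> absolutely_continuous_on C (slope k r)"
  unfolding slope_def[abs_def] by (intro absolutely_continuous_on_scaled_diff ac) auto

lemma continuous_slope: "k \<in> R \<Longrightarrow> r \<in> R \<Longrightarrow> k < r \<Longrightarrow> continuous_on C (slope k r)"
  by (intro absolutely_continuous_on_imp_continuous_on absolutely_continuous_slope)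

text \<open>Otherwise \<open>R\<close>, and with it its convex hull, would lie in the convex
  half-line above \<open>x\<close>, which omits \<open>x\<close>.\<close>

lemma exists_lower: "x \<in> C \<Longrightarrow> \<exists>k\<in>R. k \<le> x"
  using hull_minimal[of R "{x<..}" convex] unfolding hull by (force simp: not_le)

lemma exists_upper: "x \<in> C \<Longrightarrow> \<exists>r\<in>R. x \<le> r"
  using hull_minimal[of R "{..<x}" convex] unfolding hull by (force simp: not_le)

text \<open>Writing \<open>a r\<close> as \<open>a k + (r - k) * slope k r\<close> turns the
  two-point inequality into \<open>r - k\<close> times the claim.\<close>

lemma slope_bound:
  assumes "k \<in> R" "r \<in> R" "k < t" "t < r" "x \<in> C"
  shows "a k x - a k t \<le> (k - t) * (slope k r x - slope k r t)"
proof -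
  have "(r - k) * (a k x - a k t) \<le> (r - k) * ((k - t) * (slope k r x - slope k r t))"
    using two_point[OF assms] slope_mult[of k r x] slope_mult[of k r t] assms
    by (simp add: algebra_simps)
  then show ?thesis using assms by (simp add: mult_le_cancel_left)
qed

text \<open>The two-point inequality covers \<open>t\<close> strictly between \<open>k\<close> and
  \<open>r\<close>; continuity in \<open>t\<close> adds the end points.\<close>

lemma stieltjes_bound_slope_left:
  assumes "k \<in> R" "r \<in> R" "k < r"
  shows "stieltjes_bound k (a k) (slope k r) {k..r}"
  unfolding stieltjes_bound_def
proof (intro ballI)
  fix x t assume x: "x \<in> {k..r}" and t: "t \<in> {k..r}"
  have sub: "{k..r} \<subseteq> C" using Icc_subset_C assms by simp
  have cont: "continuous_on {k..r} (a k)" "continuous_on {k..r} (slope k r)"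
    using assms sub ac[OF assms(1)] continuous_slope[OF assms]
    by (auto intro: continuous_on_subset absolutely_continuous_on_imp_continuous_on)
  have cl: "closure {k<..<r} = {k..r}" using \<open>k < r\<close> by simp
  have "0 \<le> (k - t) * (slope k r x - slope k r t) - (a k x - a k t)"
  proof (rule continuous_ge_on_closure[of "{k<..<r}" "\<lambda>t. (k - t) * (slope k r x - slope k r t) - (a k x - a k t)" t 0])
    show "continuous_on (closure {k<..<r}) (\<lambda>t. (k - t) * (slope k r x - slope k r t) - (a k x - a k t))"
      unfolding cl by (intro continuous_intros cont)
    show "t \<in> closure {k<..<r}" using t cl by simp
    fix s assume "s \<in> {k<..<r}"
    then show "0 \<le> (k - s) * (slope k r x - slope k r s) - (a k x - a k s)"
      using slope_bound[of k r s x] assms x sub by auto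
  qed
  then show "a k x - a k t \<le> (k - t) * (slope k r x - slope k r t)" by simp
qed

lemma stieltjes_bound_slope_right:
  assumes "k \<in> R" "r \<in> R" "k < r"
  shows "stieltjes_bound r (a r) (slope k r) {k..r}"
  by (rule stieltjes_bound_shift[OF stieltjes_bound_slope_left[OF assms], where c = 0])
     (use slope_mult[of k r] assms in simp)

text \<open>For \<open>u < k < v\<close>, both \<open>slope u k\<close> and \<open>slope u v\<close>
  serve as integrators for \<open>a u\<close> on \<open>{u..k}\<close>, so they differ there by a
  constant; likewise \<open>slope k v\<close> and \<open>slope u v\<close> for \<open>a v\<close> on
  \<open>{k..v}\<close>. This gives the formula on each half.\<close>

lemma score_affine_in_slope:
  assumes R: "u \<in> R" "k \<in> R" "v \<in> R" and "u \<le> k" "k \<le> v" "u < v"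
  obtains c where "\<forall>x\<in>{u..v}. a k x = a u x + (k - u) * slope u v x + c"
proof -
  consider "k = u" | "k = v" | "u < k" "k < v" using assms by linarith
  then show thesis
  proof cases
    case 1
    then show ?thesis by (intro that[of 0]) simp
  next
    case 2
    then show ?thesis using slope_mult[of u v] \<open>u < v\<close> by (intro that[of 0]) simp
  next
    case 3
    have subs: "{u..k} \<subseteq> {u..v}" "{k..v} \<subseteq> {u..v}" using 3 by auto
    have cont: "continuous_on {x..y} (slope p q)"
      if "p \<in> R" "q \<in> R" "p < q" "x \<in> R" "y \<in> R" for p q x y
      using that Icc_subset_C[of x y] continuous_slope by (auto intro: continuous_on_subset)
    obtain c1 where c1: "\<forall>x\<in>{u..k}. slope u k x = slope u v x + c1"
      by (rule stieltjes_bound_unique_Icc[OF stieltjes_bound_slope_left[of u k]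
            stieltjes_bound_subset[OF stieltjes_bound_slope_left[of u v] subs(1)] cont[of u k u k] cont[of u v u k]])
         (use R 3 in auto)
    obtain c2 where c2: "\<forall>x\<in>{k..v}. slope k v x = slope u v x + c2"
      by (rule stieltjes_bound_unique_Icc[OF stieltjes_bound_slope_right[of k v]
            stieltjes_bound_subset[OF stieltjes_bound_slope_right[of u v] subs(2)] cont[of k v k v] cont[of u v k v]])
         (use R 3 in auto)
    have 1: "a k x = a u x + (k - u) * slope u v x + (k - u) * c1" if "x \<in> {u..k}" for x
      using slope_mult[of u k x] c1[rule_format, OF that] 3 by (simp add: algebra_simps)
    have 2: "a k x = a u x + (k - u) * slope u v x - (v - k) * c2" if "x \<in> {k..v}" for x
      using slope_mult[of k v x] slope_mult[of u v x] c2[rule_format, OF that] 3 by (simp add: algebra_simps)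
    \<comment> \<open>Both formulas hold at the common point \<open>k\<close>, which forces their
      constants to agree.\<close>
    have eq: "(k - u) * c1 = - ((v - k) * c2)" using 1[of k] 2[of k] 3 by simp
    show ?thesis
    proof (rule that[of "(k - u) * c1"], rule ballI)
      fix x assume "x \<in> {u..v}"
      then show "a k x = a u x + (k - u) * slope u v x + (k - u) * c1"
        using 1[of x] 2[of x] eq by (cases "x \<le> k") simp_all
    qed
  qed
qed

lemma stieltjes_bound_slope_Icc:
  assumes "u \<in> R" "k \<in> R" "v \<in> R" "u \<le> k" "k \<le> v" "u < v"
  shows "stieltjes_bound k (a k) (slope u v) {u..v}"
proof -
  obtain c where "\<forall>x\<in>{u..v}. a k x = a u x + (k - u) * slope u v x + c"
    using score_affine_in_slope[OF assms] .
  then show ?thesis using assms by (intro stieltjes_bound_shift[OF stieltjes_bound_slope_left]) auto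
qed

text \<open>Both \<open>a p\<close> and \<open>a q\<close> are \<open>a u\<close> plus a multiple of
  \<open>slope u v\<close> plus a constant. In their difference \<open>a u\<close> cancels and
  \<open>(q - p) * slope u v\<close> plus a constant remains.\<close>

lemma slope_increments_eq:
  assumes "u \<in> R" "p \<in> R" "q \<in> R" "v \<in> R" "u \<le> p" "p < q" "q \<le> v" "x \<in> {u..v}" "t \<in> {u..v}"
  shows "slope p q x - slope p q t = slope u v x - slope u v t"
proof -
  obtain c where c: "\<forall>x\<in>{u..v}. a p x = a u x + (p - u) * slope u v x + c"
    using score_affine_in_slope[of u p v] assms by auto
  obtain d where d: "\<forall>x\<in>{u..v}. a q x = a u x + (q - u) * slope u v x + d"
    using score_affine_in_slope[of u q v] assms by auto
  have "(q - p) * slope p q y = (q - p) * slope u v y + (d - c)" if "y \<in> {u..v}" for y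
    using slope_mult[of p q y] c[rule_format, OF that] d[rule_format, OF that] \<open>p < q\<close> by (simp add: algebra_simps)
  from this[OF assms(8)] this[OF assms(9)]
  have "(q - p) * (slope p q x - slope p q t) = (q - p) * (slope u v x - slope u v t)"
    by (simp add: algebra_simps)
  then show ?thesis using \<open>p < q\<close> by simp
qed

text \<open>Reduces statements about finitely many points of \<open>C\<close> to an interval with
  end points in \<open>R\<close>, even if \<open>C\<close> is unbounded or not closed.\<close>

lemma exists_enclosing:
  assumes "finite S" "S \<noteq> {}" "S \<subseteq> C"
  obtains u v where "u \<in> R" "v \<in> R" "S \<subseteq> {u..v}"
proof -
  have "Min S \<in> C" "Max S \<in> C" using Min_in Max_in assms by blast+
  then obtain u v where u: "u \<in> R" "u \<le> Min S" and v: "v \<in> R" "Max S \<le> v"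
    using exists_lower exists_upper by blast
  have "S \<subseteq> {u..v}" using u v assms by (auto intro: order_trans[OF _ Min_le] order_trans[OF Max_ge])
  then show thesis by (rule that[OF u(1) v(1)])
qed

text \<open>Here one fixed pair \<open>p, q\<close> comes to serve all of \<open>C\<close> and every
  \<open>k\<close>: the bound holds for \<open>slope u v\<close> on an interval enclosing all points
  involved, and \<open>slope p q\<close> has the same increments there.\<close>

lemma stieltjes_bound_slope:
  assumes "p \<in> R" "q \<in> R" "p < q" "k \<in> R"
  shows "stieltjes_bound k (a k) (slope p q) C"
  unfolding stieltjes_bound_def
proof (intro ballI)
  fix x t assume xt: "x \<in> C" "t \<in> C"
  obtain u v where uv: "u \<in> R" "v \<in> R" "{p, q, k, x, t} \<subseteq> {u..v}"
    using assms xt R_subset_C by (auto intro: exists_enclosing[of "{p, q, k, x, t}"])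
  have "a k x - a k t \<le> (k - t) * (slope u v x - slope u v t)"
    using uv assms by (intro stieltjes_boundD[OF stieltjes_bound_slope_Icc]) auto
  also have "slope u v x - slope u v t = slope p q x - slope p q t"
    using uv assms by (intro slope_increments_eq[symmetric]) auto
  finally show "a k x - a k t \<le> (k - t) * (slope p q x - slope p q t)" .
qed

text \<open>If the slope had equal values at \<open>y < z\<close>, it would be constant between
  them. Strict propriety with expectation \<open>t\<close> against \<open>x\<close>, and with
  expectation \<open>x\<close> against \<open>t\<close>, would then give
  \<open>a u x < a u t\<close> and \<open>a u t < a u x\<close>.\<close>

lemma strict_mono_on_slope:
  assumes pq: "p \<in> R" "q \<in> R" "p < q"
    and strict: "\<And>k r t x. \<lbrakk>k \<in> R; r \<in> R; k < t; t < r; x \<in> C; x \<noteq> t\<rbrakk>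
      \<Longrightarrow> (r - t) * a k x + (t - k) * a r x < (r - t) * a k t + (t - k) * a r t"
  shows "strict_mono_on C (slope p q)"
proof (rule strict_mono_onI)
  fix y z assume yz: "y \<in> C" "z \<in> C" "y < z"
  have mono: "mono_on C (slope p q)"
    by (rule stieltjes_bound_mono_on[OF stieltjes_bound_slope[OF pq pq(1)]])
  show "slope p q y < slope p q z"
  proof (rule ccontr)
    assume "\<not> slope p q y < slope p q z"
    then have eq: "slope p q y = slope p q z" using mono_onD[OF mono, of y z] yz by simp
    obtain u v where uv: "u \<in> R" "v \<in> R" "{p, q, y, z} \<subseteq> {u..v}"
      using pq yz R_subset_C by (auto intro: exists_enclosing[of "{p, q, y, z}"])
    \<comment> \<open>Two points strictly inside \<open>{y..z}\<close>, hence strictly between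
      \<open>u\<close> and \<open>v\<close>, so that each can be the expectation of a two-point
      probability.\<close>
    define x where "x = (2 * y + z) / 3"
    define t where "t = (y + 2 * z) / 3"
    have xt: "y < x" "x < t" "t < z" using yz by (auto simp: x_def t_def)
    have inC: "x \<in> C" "t \<in> C" using convex_real_Icc_subset[OF convex_C yz(1,2)] xt by auto
    have "slope p q x = slope p q t"
      using eq xt inC mono_onD[OF mono, of y x] mono_onD[OF mono, of x t] mono_onD[OF mono, of t z] yz by simp
    then have suv: "slope u v x = slope u v t"
      using slope_increments_eq[of u p q v x t] uv pq xt by auto
    have "u < v" using uv pq by auto
    then have av: "a v s = a u s + (v - u) * slope u v s" for s by (rule slope_mult[OF less_imp_neq])
    have "(v - t) * a u x + (t - u) * a v x < (v - t) * a u t + (t - u) * a v t"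
      using uv xt inC by (intro strict) auto
    then have "(v - u) * a u x < (v - u) * a u t"
      unfolding av suv by (simp add: algebra_simps)
    moreover have "(v - x) * a u t + (x - u) * a v t < (v - x) * a u x + (x - u) * a v x"
      using uv xt inC by (intro strict) auto
    then have "(v - u) * a u t < (v - u) * a u x"
      unfolding av suv by (simp add: algebra_simps)
    ultimately show False by simp
  qed
qed

lemma degenerate_or_slope:
  obtains c where "R \<subseteq> {c}" | p q where "p \<in> R" "q \<in> R" "p < q"
  by (metis insertI1 linorder_neqE subsetI)

text \<open>With at most one value, every integral runs from a point to itself, no
  \<open>t \<noteq> k\<close> is left in \<open>C\<close>, and \<open>C\<close> is null. Strict
  positivity is vacuous as well, since \<open>C\<close> contains no two points.\<close>

lemma degenerate_representation:
  assumes "R \<subseteq> {c}"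
  shows "C \<subseteq> {c}" "integral_representation R C a (\<lambda>_. 0)" "derivative_formula R C a (\<lambda>_. 0)"
proof -
  show C: "C \<subseteq> {c}" unfolding hull by (rule hull_minimal[OF assms]) simp
  then have eq: "x = k" if "x \<in> C" "k \<in> R" for x k using assms that by auto
  show "integral_representation R C a (\<lambda>_. 0)"
    unfolding integral_representation_def
    using eq by (auto simp: interval_lebesgue_integrable_def set_integrable_def)
  have "AE t in lborel. t \<noteq> c" by (rule AE_lborel_singleton)
  then show "derivative_formula R C a (\<lambda>_. 0)"
    unfolding derivative_formula_def using C assms by (auto elim!: eventually_mono)
qed

lemma representation:
  "\<exists>m. positive_on C m \<and> integral_representation R C a m \<and> derivative_formula R C a m"
proof (rule degenerate_or_slope)
  fix c assume "R \<subseteq> {c}"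
  from degenerate_representation[OF this] show ?thesis
    by (intro exI[of _ "\<lambda>_. 0"]) (simp add: positive_on_def)
next
  fix p q assume pq: "p \<in> R" "q \<in> R" "p < q"
  note * = convex_C absolutely_continuous_slope[OF pq] stieltjes_bound_slope[OF pq] R_subset_C
  show ?thesis
    using stieltjes_bound_integral_representation[OF *] stieltjes_bound_derivative_formula[OF *]
    by (intro exI[of _ "slope_density C (slope p q)"]) (simp add: positive_on_def slope_density_nonneg)
qed

lemma strict_representation:
  assumes strict: "\<And>k r t x. \<lbrakk>k \<in> R; r \<in> R; k < t; t < r; x \<in> C; x \<noteq> t\<rbrakk>
      \<Longrightarrow> (r - t) * a k x + (t - k) * a r x < (r - t) * a k t + (t - k) * a r t"
  shows "\<exists>m. strictly_positive_on C m \<and> integral_representation R C a m \<and> derivative_formula R C a m"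
proof (rule degenerate_or_slope)
  fix c assume c: "R \<subseteq> {c}"
  have "u \<in> C \<Longrightarrow> v \<in> C \<Longrightarrow> \<not> u < v" for u v using degenerate_representation(1)[OF c] by auto
  then show ?thesis using degenerate_representation[OF c]
    by (intro exI[of _ "\<lambda>_. 0"]) (auto simp: strictly_positive_on_def positive_on_def)
next
  fix p q assume pq: "p \<in> R" "q \<in> R" "p < q"
  note * = convex_C absolutely_continuous_slope[OF pq] stieltjes_bound_slope[OF pq] R_subset_C
  have "strictly_positive_on C (slope_density C (slope p q))"
    by (rule strictly_positive_on_slope_density[OF *(1,2) strict_mono_on_slope[OF pq strict]])
  then show ?thesis
    using stieltjes_bound_integral_representation[OF *] stieltjes_bound_derivative_formula[OF *] by blast
qed

end

section \<open>From two-point probabilities to inequalities between scores\<close>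

lemma exists_two_point_prob:
  assumes "k \<in> V ` \<Omega>" "r \<in> V ` \<Omega>" "k < t" "t < r"
  obtains p where "p \<in> two_point_probs \<Omega> V" "measure_pmf.expectation p V = t"
    "\<forall>f :: real \<Rightarrow> real. measure_pmf.expectation p (\<lambda>\<omega>. f (V \<omega>)) = ((r - t) * f k + (t - k) * f r) / (r - k)"
proof -
  obtain \<omega> \<omega>' where w: "\<omega> \<in> \<Omega>" "V \<omega> = k" "\<omega>' \<in> \<Omega>" "V \<omega>' = r" using assms by auto
  \<comment> \<open>The weight of the point with value \<open>r\<close>, determined by the
    requirement that the expectation of \<open>V\<close> be \<open>t\<close>.\<close>
  define q where "q = (t - k) / (r - k)"
  have q: "0 < q" "q < 1" using assms by (auto simp: q_def)
  have q1: "1 - q = (r - t) / (r - k)" using assms by (simp add: q_def field_simps)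
  define p where "p = map_pmf (\<lambda>b. if b then \<omega>' else \<omega>) (bernoulli_pmf q)"
  \<comment> \<open>Kept general in \<open>f\<close>: the identity gives the expectation of
    \<open>V\<close>, and the scores at two estimates give both sides of propriety.\<close>
  have E: "measure_pmf.expectation p (\<lambda>\<omega>. f (V \<omega>)) = ((r - t) * f k + (t - k) * f r) / (r - k)"
    for f :: "real \<Rightarrow> real"
    using q w by (simp add: p_def q1) (simp add: q_def add_divide_distrib mult.commute add.commute)
  show thesis
  proof (rule that)
    have "set_pmf p = {\<omega>, \<omega>'}"
      using q by (auto simp: p_def set_pmf_bernoulli UNIV_bool)
    moreover have "V \<omega> < V \<omega>'" using w assms by simp
    ultimately show "p \<in> two_point_probs \<Omega> V" using w(1,3) unfolding two_point_probs_def by blast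
    have "(r - t) * k + (t - k) * r = t * (r - k)" by (simp add: algebra_simps)
    then show "measure_pmf.expectation p V = t" using E[of "\<lambda>x. x"] assms by simp
  qed (use E in blast)
qed

lemma two_point_probs_subset_fin_probs: "two_point_probs \<Omega> V \<subseteq> fin_probs \<Omega>"
  unfolding two_point_probs_def fin_probs_def by auto

text \<open>Both expected scores carry the positive factor \<open>1 / (r - k)\<close>; cancelling it
  leaves the unnormalised weights \<open>r - t\<close> and \<open>t - k\<close>.\<close>

lemma proper_for_two_point_probsD:
  assumes "proper_for (two_point_probs \<Omega> V) \<Omega> V a"
    and kr: "k \<in> V ` \<Omega>" "r \<in> V ` \<Omega>" "k < t" "t < r" and x: "x \<in> convex hull (V ` \<Omega>)"
  shows "(r - t) * a k x + (t - k) * a r x \<le> (r - t) * a k t + (t - k) * a r t"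
proof -
  obtain p where p: "p \<in> two_point_probs \<Omega> V" "measure_pmf.expectation p V = t"
    "\<forall>f :: real \<Rightarrow> real. measure_pmf.expectation p (\<lambda>\<omega>. f (V \<omega>)) = ((r - t) * f k + (t - k) * f r) / (r - k)"
    using exists_two_point_prob[OF kr] .
  have "measure_pmf.expectation p (\<lambda>\<omega>. a (V \<omega>) x) \<le> measure_pmf.expectation p (\<lambda>\<omega>. a (V \<omega>) t)"
    using assms(1) p(1,2) x unfolding proper_for_def by metis
  then show ?thesis
    using kr unfolding p(3)[THEN spec, of "\<lambda>k. a k x"] p(3)[THEN spec, of "\<lambda>k. a k t"] by (simp add: divide_le_cancel)
qed

lemma strictly_proper_for_two_point_probsD:
  assumes "strictly_proper_for (two_point_probs \<Omega> V) \<Omega> V a"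
    and kr: "k \<in> V ` \<Omega>" "r \<in> V ` \<Omega>" "k < t" "t < r" and x: "x \<in> convex hull (V ` \<Omega>)" "x \<noteq> t"
  shows "(r - t) * a k x + (t - k) * a r x < (r - t) * a k t + (t - k) * a r t"
proof -
  obtain p where p: "p \<in> two_point_probs \<Omega> V" "measure_pmf.expectation p V = t"
    "\<forall>f :: real \<Rightarrow> real. measure_pmf.expectation p (\<lambda>\<omega>. f (V \<omega>)) = ((r - t) * f k + (t - k) * f r) / (r - k)"
    using exists_two_point_prob[OF kr] .
  have "measure_pmf.expectation p (\<lambda>\<omega>. a (V \<omega>) x) < measure_pmf.expectation p (\<lambda>\<omega>. a (V \<omega>) t)"
    using assms(1) p(1,2) x unfolding strictly_proper_for_def by metis
  then show ?thesis
    using kr unfolding p(3)[THEN spec, of "\<lambda>k. a k x"] p(3)[THEN spec, of "\<lambda>k. a k t"] by (simp add: divide_less_cancel)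
qed

lemma strictly_proper_for_imp_proper_for: "strictly_proper_for P \<Omega> V a \<Longrightarrow> proper_for P \<Omega> V a"
  unfolding strictly_proper_for_def proper_for_def by (metis less_imp_le order_refl)

lemma proper_for_antimono: "proper_for P \<Omega> V a \<Longrightarrow> Q \<subseteq> P \<Longrightarrow> proper_for Q \<Omega> V a"
  unfolding proper_for_def by blast

lemma strictly_proper_for_antimono:
  "strictly_proper_for P \<Omega> V a \<Longrightarrow> Q \<subseteq> P \<Longrightarrow> strictly_proper_for Q \<Omega> V a"
  unfolding strictly_proper_for_def by blast

theorem mainTheorem1:
  fixes \<Omega> :: "'w set" and V :: "'w \<Rightarrow> real" and a :: "real \<Rightarrow> real \<Rightarrow> real"
    and R C :: "real set"
  assumes "\<Omega> \<noteq> {}"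
    and "R = V ` \<Omega>"
    and "C = convex hull R"
    and "\<And>k. k \<in> R \<Longrightarrow> absolutely_continuous_on C (a k)"
  shows
    "(proper \<Omega> V a \<longrightarrow>
       (\<exists>m. positive_on C m \<and> integral_representation R C a m \<and> derivative_formula R C a m)) \<and>
     (strictly_proper \<Omega> V a \<longrightarrow>
       (\<exists>m. strictly_positive_on C m \<and> integral_representation R C a m \<and>
            derivative_formula R C a m)) \<and>
     (proper_for (two_point_probs \<Omega> V) \<Omega> V a \<longrightarrow>
       (\<exists>m. positive_on C m \<and> integral_representation R C a m \<and> derivative_formula R C a m)) \<and>
     (strictly_proper_for (two_point_probs \<Omega> V) \<Omega> V a \<longrightarrow>
       (\<exists>m. strictly_positive_on C m \<and> integral_representation R C a m \<and>
            derivative_formula R C a m))"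
proof -
  have tpp: "two_point_propriety R C a" if "proper_for (two_point_probs \<Omega> V) \<Omega> V a"
    using assms(3,4) proper_for_two_point_probsD[OF that]
    unfolding two_point_propriety_def assms(2) by auto
  have pos: "\<exists>m. positive_on C m \<and> integral_representation R C a m \<and> derivative_formula R C a m"
    if "proper_for (two_point_probs \<Omega> V) \<Omega> V a"
    using tpp[OF that] by (rule two_point_propriety.representation)
  have strict: "\<exists>m. strictly_positive_on C m \<and> integral_representation R C a m \<and> derivative_formula R C a m"
    if "strictly_proper_for (two_point_probs \<Omega> V) \<Omega> V a"
    using tpp[OF strictly_proper_for_imp_proper_for[OF that]]
    by (rule two_point_propriety.strict_representation)
       (use strictly_proper_for_two_point_probsD[OF that] assms(2,3) in simp)
  \<comment> \<open>Two-point probabilities are finitely supported, so propriety for all finitely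
    supported probabilities restricts to them.\<close>
  show ?thesis
    using pos strict proper_for_antimono[OF _ two_point_probs_subset_fin_probs]
      strictly_proper_for_antimono[OF _ two_point_probs_subset_fin_probs]
    unfolding proper_def strictly_proper_def by blast
qed

end
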